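(* Let $K$ be a compact hypergroup with Haar measure $\omega$ and let $\sigma$ be an adapted probability measure on $K$. Then $H^p_\sigma(K)=\mathbb{C}1$ for all $1\leq p\leq\infty$.
   Context: $K$ is a compact hypergroup (Jewett/Bloom–Heyer sense) with involution $x\mapsto\check x$ and left Haar measure $\omega$; $L^p(K)$ is taken with respect to $\omega$. For a Borel function $f$, $f(x*y)=\int_K f\,d(\delta_x*\delta_y)$, and for $\mu\in M(K)$, $(\mu*f)(x)=\int_K f(\check y*x)\,d\mu(y)$. $H^p_\sigma(K)=\{f\in L^p(K):\sigma*f=f\}$, and $1$ is the constant function one. For subsets $A,B\subseteq K$, $A*B=\bigcup_{a\in A,b\in B}\operatorname{supp}(\delta_a*\delta_b)$, $A^n$ is the $n$-fold product and $\check A=\{\check a: a\in A\}$. A measure $\mu\in M(K)$ is adapted if $K=\overline{\bigcup_{n\geq1}\left(\operatorname{supp}|\mu|\cup(\operatorname{supp}|\mu|)\check{}\right)^n}$. *)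

theory Defs
  imports "HOL-Probability.Probability"
begin

text \<open>Compact hypergroups (Jewett / Bloom--Heyer), modelled on the whole of a compact
Hausdorff type 'a.  The convolution of point masses is given by
conv x y = delta_x * delta_y, a Borel probability measure; invo is the involution;
e is the identity.\<close>

definition msupp :: "'a::topological_space measure \<Rightarrow> 'a set" where
  "msupp M = {x. \<forall>U. open U \<and> x \<in> U \<longrightarrow> emeasure M U \<noteq> 0}"

definition radon_measure :: "'a::t2_space measure \<Rightarrow> bool" where
  "radon_measure M \<longleftrightarrow> sets M = sets borel \<and> finite_measure M \<and>
     (\<forall>A\<in>sets M. emeasure M A = (SUP C\<in>{C. compact C \<and> C \<subseteq> A}. emeasure M C))"

definition hval :: "('a \<Rightarrow> 'a \<Rightarrow> 'a measure) \<Rightarrow> ('a \<Rightarrow> 'b::{banach,second_countable_topology}) \<Rightarrow> 'a \<Rightarrow> 'a \<Rightarrow> 'b" where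
  "hval conv f x y = (\<integral>z. f z \<partial>conv x y)"

definition compact_hypergroup ::
  "('a::t2_space \<Rightarrow> 'a \<Rightarrow> 'a measure) \<Rightarrow> ('a \<Rightarrow> 'a) \<Rightarrow> 'a \<Rightarrow> bool" where
  "compact_hypergroup conv invo e \<longleftrightarrow>
     compact (UNIV :: 'a set) \<and>
     \<comment> \<open>(H1) delta_x * delta_y is a (Radon) probability measure (compact support is automatic)\<close>
     (\<forall>x y. prob_space (conv x y) \<and> radon_measure (conv x y)) \<and>
     \<comment> \<open>associativity of convolution of point masses\<close>
     (\<forall>x y z f. continuous_on UNIV (f :: 'a \<Rightarrow> real) \<longrightarrow>
        (\<integral>u. hval conv f u z \<partial>conv x y) = (\<integral>v. hval conv f x v \<partial>conv y z)) \<and>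
     \<comment> \<open>(H2) weak continuity of (x,y) to delta_x * delta_y\<close>
     (\<forall>f. continuous_on UNIV (f :: 'a \<Rightarrow> real) \<longrightarrow>
        continuous_on UNIV (\<lambda>(x,y). hval conv f x y)) \<and>
     \<comment> \<open>(H3) continuity of supports in the Michael (Vietoris) topology\<close>
     (\<forall>U. open U \<longrightarrow> open {(x,y). msupp (conv x y) \<subseteq> U}) \<and>
     (\<forall>U. open U \<longrightarrow> open {(x,y). msupp (conv x y) \<inter> U \<noteq> {}}) \<and>
     \<comment> \<open>(H4) identity\<close>
     (\<forall>x. conv e x = return borel x \<and> conv x e = return borel x) \<and>
     \<comment> \<open>(H5) involution\<close>
     continuous_on UNIV invo \<and> (\<forall>x. invo (invo x) = x) \<and>
     (\<forall>x y. distr (conv x y) borel invo = conv (invo y) (invo x)) \<and>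
     \<comment> \<open>(H6)\<close>
     (\<forall>x y. e \<in> msupp (conv x y) \<longleftrightarrow> x = invo y)"

definition left_haar_measure :: "('a::t2_space \<Rightarrow> 'a \<Rightarrow> 'a measure) \<Rightarrow> 'a measure \<Rightarrow> bool" where
  "left_haar_measure conv \<omega> \<longleftrightarrow> radon_measure \<omega> \<and> emeasure \<omega> UNIV \<noteq> 0 \<and>
     (\<forall>x f. continuous_on UNIV (f :: 'a \<Rightarrow> real) \<longrightarrow>
        (\<integral>y. hval conv f x y \<partial>\<omega>) = (\<integral>y. f y \<partial>\<omega>))"

definition setconv :: "('a::topological_space \<Rightarrow> 'a \<Rightarrow> 'a measure) \<Rightarrow> 'a set \<Rightarrow> 'a set \<Rightarrow> 'a set" where
  "setconv conv A B = (\<Union>a\<in>A. \<Union>b\<in>B. msupp (conv a b))"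

text \<open>setpow conv A n is the (n+1)-fold product A^(n+1)\<close>
primrec setpow :: "('a::topological_space \<Rightarrow> 'a \<Rightarrow> 'a measure) \<Rightarrow> 'a set \<Rightarrow> nat \<Rightarrow> 'a set" where
  "setpow conv A 0 = A"
| "setpow conv A (Suc n) = setconv conv (setpow conv A n) A"

definition adapted ::
  "('a::topological_space \<Rightarrow> 'a \<Rightarrow> 'a measure) \<Rightarrow> ('a \<Rightarrow> 'a) \<Rightarrow> 'a measure \<Rightarrow> bool" where
  "adapted conv invo \<mu> \<longleftrightarrow>
     UNIV = closure (\<Union>n. setpow conv (msupp \<mu> \<union> invo ` msupp \<mu>) n)"

definition mconv_fun ::
  "('a \<Rightarrow> 'a \<Rightarrow> 'a measure) \<Rightarrow> ('a \<Rightarrow> 'a) \<Rightarrow> 'a measure \<Rightarrow> ('a \<Rightarrow> complex) \<Rightarrow> 'a \<Rightarrow> complex" where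
  "mconv_fun conv invo \<mu> f x = (\<integral>y. hval conv f (invo y) x \<partial>\<mu>)"

definition Lp_mem :: "'a measure \<Rightarrow> ennreal \<Rightarrow> ('a \<Rightarrow> complex) \<Rightarrow> bool" where
  "Lp_mem M p f \<longleftrightarrow> f \<in> borel_measurable M \<and>
     (if p = \<infinity> then (\<exists>C. AE x in M. norm (f x) \<le> C)
      else integrable M (\<lambda>x. norm (f x) powr enn2real p))"

end

theory Submission
  imports Defs
begin

text \<open>
  Fubini's theorem for continuous functions shows that \<omega> is invariant under the involution. Axioms (H3)
  and (H6) give approximate identities k, and with them left translation by the involute of x is adjoint
  to left translation by x. Convolving a \<sigma>-harmonic f in \<open>L\<^sup>1\<close> with k on the right produces a continuous
  \<sigma>-harmonic F. The integral of \<open>(F(u) - F(x))\<^sup>2\<close> over u distributed as y * x and x distributed as \<omega>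
  is unchanged when y is replaced by its involute, and its \<sigma>-average over y vanishes by harmonicity;
  hence F is invariant under translation by the support of \<sigma> and its involute, by their products, and by
  adaptedness by all of K, so F is constant. Letting k tend to the unit mass at e, f is constant
  almost everywhere.

  K need not be second countable, so convolution of \<sigma> with Borel functions is controlled through
  \<tau>-additivity of Radon measures: the kernel \<open>transition\<close> integrates lower semicontinuous
  functions as directed suprema of continuous ones.
\<close>

subsection \<open>Radon measures on compact Hausdorff spaces\<close>

text \<open>By left invariance the integral over x of the squared difference equals 2 |F|^2 - 2 <F,
  T F>, with T the left translation by y and norm and product those of \<open>L^2\<close>.
  Adjointness makes this symmetric in y and its involute, and harmonicity turns the \<sigma>-average
  of <F, T F> into |F|^2. Squares are used because their vanishing says that F is constant on whole
  supports, a property that survives products. Smoothing on the right preserves harmonicity because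
  it commutes with convolution by \<sigma> on the left. The limit along k is taken weakly: tested
  against a continuous g, f gives its mean times the integral of g, and such tests determine f
  almost everywhere. A further obstacle is that (\<sigma> * f)(x) is an iterated Bochner integral,
  which silently takes the value 0 where integrability fails. Collecting it into an integral of f
  against one measure for each x, a kernel that leaves \<omega> invariant, shows that integrability
  fails only on an \<omega>-null set of x.\<close>

lemma compact_t2_Urysohn:
  fixes C U :: "'a::t2_space set"
  assumes "compact (UNIV :: 'a set)" "closed C" "open U" "C \<subseteq> U"
  obtains g :: "'a \<Rightarrow> real" where "continuous_on UNIV g" "\<And>x. 0 \<le> g x" "\<And>x. g x \<le> 1"
    "\<And>x. x \<in> C \<Longrightarrow> g x = 1" "\<And>x. x \<notin> U \<Longrightarrow> g x = 0"
proof -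
  have "Hausdorff_space (euclidean :: 'a topology)"
    unfolding Hausdorff_space_def disjnt_def by (auto dest!: hausdorff)
  then have "normal_space (euclidean :: 'a topology)"
    using assms(1) by (intro compact_Hausdorff_or_regular_imp_normal_space) (auto simp: compact_space_def)
  moreover have "closedin (euclidean :: 'a topology) (- U)" "closedin (euclidean :: 'a topology) C"
    "disjnt (- U) C"
    using assms by (auto simp: disjnt_def)
  ultimately obtain f where f: "continuous_map (euclidean :: 'a topology) (top_of_set {0..1::real}) f"
      "f ` (- U) \<subseteq> {0}" "f ` C \<subseteq> {1}"
    using Urysohn_lemma[of "euclidean :: 'a topology" "- U" C 0 1] by auto
  show thesis
  proof (rule that)
    show "continuous_on UNIV f" using f(1) by (auto simp: continuous_map_in_subtopology)
    show "0 \<le> f x" "f x \<le> 1" for x using f(1) by (auto simp: continuous_map_in_subtopology)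
  qed (use f in auto)
qed

lemma directed_finite_upper_bound:
  fixes f :: "'i \<Rightarrow> 'a \<Rightarrow> 'b::order"
  assumes "\<And>i j. i \<in> I \<Longrightarrow> j \<in> I \<Longrightarrow> \<exists>k\<in>I. f i \<le> f k \<and> f j \<le> f k" "I \<noteq> {}"
    and "finite J" "J \<subseteq> I"
  shows "\<exists>k\<in>I. \<forall>j\<in>J. f j \<le> f k"
  using assms(3,4)
proof (induction J)
  case empty then show ?case using assms(2) by auto
next
  case (insert j J)
  then obtain k where k: "k \<in> I" "\<forall>j\<in>J. f j \<le> f k" by auto
  obtain l where "l \<in> I" "f j \<le> f l" "f k \<le> f l" using assms(1)[of j k] k insert by auto
  then show ?case using k by (intro bexI[of _ l]) (auto intro: order_trans)
qed

text \<open>The sets where \<open>f i\<close> exceeds \<open>t\<close> are open and cover C, so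
  finitely many indices suffice, and directedness replaces these by a single one. This is the core
  of Dini's theorem.\<close>

lemma directed_above_on_compact:
  fixes f :: "'i \<Rightarrow> 'a::topological_space \<Rightarrow> 'b::order"
  assumes "\<And>i j. i \<in> I \<Longrightarrow> j \<in> I \<Longrightarrow> \<exists>k\<in>I. f i \<le> f k \<and> f j \<le> f k" "I \<noteq> {}"
    and "\<And>i. i \<in> I \<Longrightarrow> open {x. t < f i x}" "compact C" "\<And>x. x \<in> C \<Longrightarrow> \<exists>i\<in>I. t < f i x"
  shows "\<exists>k\<in>I. \<forall>x\<in>C. t < f k x"
proof -
  obtain J where J: "J \<subseteq> I" "finite J" "C \<subseteq> (\<Union>i\<in>J. {x. t < f i x})"
    using assms(3,4,5) by (elim compactE_image[of C I "\<lambda>i. {x. t < f i x}"]) blast+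
  obtain k where "k \<in> I" "\<forall>j\<in>J. f j \<le> f k"
    using directed_finite_upper_bound[of I f J] assms(1,2) J by auto
  moreover have "t < f k x" if x: "x \<in> C" for x
  proof -
    obtain j where j: "j \<in> J" "t < f j x" using x J(3) by auto
    then have "f j x \<le> f k x" using \<open>\<forall>j\<in>J. f j \<le> f k\<close> by (simp add: le_fun_def)
    with j(2) show ?thesis by (rule less_le_trans)
  qed
  ultimately show ?thesis by blast
qed

lemma ennreal_le_if_scaled_le:
  fixes S R :: ennreal
  assumes "\<And>\<theta>::real. 0 < \<theta> \<Longrightarrow> \<theta> < 1 \<Longrightarrow> ennreal \<theta> * S \<le> R"
  shows "S \<le> R"
proof (rule LIMSEQ_le_const2)
  \<comment> \<open>The double \<open>Suc\<close> gives the factor 1 - 1/(n+2), which lies strictly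
    between 0 and 1 already for n = 0.\<close>
  have "(\<lambda>n. ennreal (1 - inverse (real (Suc (Suc n)))) * S) \<longlonglongrightarrow> ennreal (1 - 0) * S"
    by (intro tendsto_mult_ennreal tendsto_ennrealI tendsto_diff tendsto_const
        LIMSEQ_inverse_real_of_nat[THEN LIMSEQ_Suc]) auto
  then show "(\<lambda>n. ennreal (1 - inverse (real (Suc (Suc n)))) * S) \<longlonglongrightarrow> S" by simp
  show "\<exists>N. \<forall>n\<ge>N. ennreal (1 - inverse (real (Suc (Suc n)))) * S \<le> R"
    by (intro exI[of _ 0] allI impI assms) (auto simp: field_simps)
qed

text \<open>The measurable sets are approximated from inside by compact sets, on which a directed family
  of lower semicontinuous functions already attains its supremum up to a factor.\<close>

lemma radon_nn_integral_directed_SUP: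
  fixes f :: "'i \<Rightarrow> 'a::t2_space \<Rightarrow> ennreal"
  assumes M: "radon_measure M"
    and dir: "\<And>i j. i \<in> I \<Longrightarrow> j \<in> I \<Longrightarrow> \<exists>k\<in>I. f i \<le> f k \<and> f j \<le> f k" "I \<noteq> {}"
    and lsc: "\<And>i t. i \<in> I \<Longrightarrow> open {x. t < f i x}"
  shows "(\<integral>\<^sup>+x. (SUP i\<in>I. f i x) \<partial>M) = (SUP i\<in>I. \<integral>\<^sup>+x. f i x \<partial>M)"
proof (rule antisym)
  have sets [measurable_cong, simp]: "sets M = sets borel" and "finite_measure M"
    and inner: "\<And>A. A \<in> sets borel \<Longrightarrow> emeasure M A = (SUP C\<in>{C. compact C \<and> C \<subseteq> A}. emeasure M C)"
    using M by (auto simp: radon_measure_def)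
  have space [simp]: "space M = UNIV" using sets_eq_imp_space_eq[OF sets] by simp
  interpret finite_measure M by fact
  let ?R = "SUP i\<in>I. \<integral>\<^sup>+x. f i x \<partial>M"
  show "(\<integral>\<^sup>+x. (SUP i\<in>I. f i x) \<partial>M) \<le> ?R"
    unfolding nn_integral_def_finite[of M "\<lambda>x. SUP i\<in>I. f i x"]
  proof (safe intro!: SUP_least)
    fix s assume s[measurable]: "simple_function M s" and le: "s \<le> (\<lambda>x. SUP i\<in>I. f i x)"
      and fin: "\<forall>x. s x < top"
    note [measurable] = borel_measurable_simple_function[OF s]
    have finV: "finite (s ` UNIV)" using simple_functionD(1)[OF s] by simp
    \<comment> \<open>The factor \<theta> is lost twice: once in replacing each level set of
      \<open>s\<close> by a compact subset, and once in lowering the level from \<open>v\<close> to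
      \<theta> times \<open>v\<close>, which lies strictly below the supremum and is therefore
      exceeded by some \<open>f i\<close>. The cases of a null level set and of v = 0, where
      strictness fails, are trivial.\<close>
    have scaled: "ennreal (\<theta>^2) * integral\<^sup>S M s \<le> ?R" if \<theta>: "0 < \<theta>" "\<theta> < 1" for \<theta> :: real
    proof -
      have scale_less: "ennreal \<theta> * a < a" if "a \<noteq> 0" "a < top" for a
      proof -
        from that obtain r where "a = ennreal r" "r > 0" by (cases a) (auto simp: ennreal_eq_0_iff)
        with \<theta> show ?thesis by (auto simp: ennreal_mult[symmetric] ennreal_less_iff)
      qed
      have A[measurable]: "s -` {v} \<in> sets borel" for v
        using simple_functionD(2)[OF s, of "{v}"] by simp
      have "\<exists>C k. compact C \<and> C \<subseteq> s -` {v} \<and> ennreal \<theta> * emeasure M (s -` {v}) \<le> emeasure M C \<and>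
              k \<in> I \<and> (\<forall>x\<in>C. ennreal \<theta> * v \<le> f k x)" if v: "v \<in> s ` UNIV" for v
      proof -
        have "\<exists>C. compact C \<and> C \<subseteq> s -` {v} \<and> ennreal \<theta> * emeasure M (s -` {v}) \<le> emeasure M C"
        proof (cases "emeasure M (s -` {v}) = 0")
          case True then show ?thesis by (intro exI[of _ "{}"]) auto
        next
          case False
          then have "ennreal \<theta> * emeasure M (s -` {v}) < (SUP C\<in>{C. compact C \<and> C \<subseteq> s -` {v}}. emeasure M C)"
            unfolding inner[OF A, symmetric]
            by (intro scale_less) (auto simp: emeasure_eq_measure)
          then show ?thesis unfolding less_SUP_iff by (auto intro: less_imp_le)
        qed
        then obtain C where C: "compact C" "C \<subseteq> s -` {v}"
            "ennreal \<theta> * emeasure M (s -` {v}) \<le> emeasure M C" by blast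
        have "\<exists>k\<in>I. \<forall>x\<in>C. ennreal \<theta> * v \<le> f k x"
        proof (cases "v = 0")
          case True then show ?thesis using dir(2) by auto
        next
          case False
          have "\<exists>i\<in>I. ennreal \<theta> * v < f i x" if "x \<in> C" for x
          proof -
            have sx: "s x = v" using that C by auto
            then have "ennreal \<theta> * v < v" using scale_less[OF False] fin by auto
            also have "v \<le> (SUP i\<in>I. f i x)" using le sx by (auto simp: le_fun_def)
            finally show ?thesis by (simp add: less_SUP_iff)
          qed
          from directed_above_on_compact[OF dir lsc C(1) this] show ?thesis
            by (meson less_imp_le)
        qed
        then show ?thesis using C by blast
      qed
      then obtain C k where Ck: "\<And>v. v \<in> s ` UNIV \<Longrightarrow> compact (C v) \<and> C v \<subseteq> s -` {v} \<and>
          ennreal \<theta> * emeasure M (s -` {v}) \<le> emeasure M (C v) \<and> k v \<in> I \<and>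
          (\<forall>x\<in>C v. ennreal \<theta> * v \<le> f (k v) x)" by metis
      obtain l where l: "l \<in> I" "\<And>v. v \<in> s ` UNIV \<Longrightarrow> f (k v) \<le> f l"
        using directed_finite_upper_bound[OF dir, of "k ` s ` UNIV"] finV Ck by blast
      have Cm: "C v \<in> sets M" if "v \<in> s ` UNIV" for v
        using Ck[OF that] by (simp add: compact_imp_closed borel_closed)
      have "ennreal (\<theta>^2) * integral\<^sup>S M s
          = (\<Sum>v\<in>s ` UNIV. (ennreal \<theta> * v) * (ennreal \<theta> * emeasure M (s -` {v})))"
        using \<theta> by (simp add: simple_integral_def sum_distrib_left power2_eq_square ennreal_mult ac_simps)
      also have "\<dots> \<le> (\<Sum>v\<in>s ` UNIV. (ennreal \<theta> * v) * emeasure M (C v))"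
        using Ck by (intro sum_mono mult_left_mono) auto
      also have "\<dots> = (\<integral>\<^sup>+x. (\<Sum>v\<in>s ` UNIV. (ennreal \<theta> * v) * indicator (C v) x) \<partial>M)"
        using Cm by (subst nn_integral_sum) (auto simp: nn_integral_cmult_indicator)
      also have "\<dots> \<le> (\<integral>\<^sup>+x. f l x \<partial>M)"
      proof (rule nn_integral_mono)
        fix x
        have "(\<Sum>v\<in>s ` UNIV. (ennreal \<theta> * v) * indicator (C v) x)
            = (\<Sum>v\<in>{s x}. (ennreal \<theta> * v) * indicator (C v) x)"
        proof (intro sum.mono_neutral_right ballI)
          fix v assume "v \<in> s ` UNIV - {s x}"
          then have "x \<notin> C v" using Ck[of v] by auto
          then show "(ennreal \<theta> * v) * indicator (C v) x = 0" by simp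
        qed (use finV in auto)
        also have "\<dots> \<le> f l x"
        proof (cases "x \<in> C (s x)")
          case True
          then have "ennreal \<theta> * s x \<le> f (k (s x)) x" using Ck[of "s x"] by auto
          also have "\<dots> \<le> f l x" using l(2)[of "s x"] by (simp add: le_fun_def)
          finally show ?thesis using True by simp
        qed simp
        finally show "(\<Sum>v\<in>s ` UNIV. (ennreal \<theta> * v) * indicator (C v) x) \<le> f l x" .
      qed
      also have "\<dots> \<le> ?R" using l(1) by (rule SUP_upper)
      finally show ?thesis .
    qed
    show "integral\<^sup>S M s \<le> ?R"
    proof (rule ennreal_le_if_scaled_le)
      fix \<theta> :: real assume "0 < \<theta>" "\<theta> < 1"
      then show "ennreal \<theta> * integral\<^sup>S M s \<le> ?R" using scaled[of "sqrt \<theta>"] by simp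
    qed
  qed
  show "?R \<le> (\<integral>\<^sup>+x. (SUP i\<in>I. f i x) \<partial>M)"
    by (intro SUP_least nn_integral_mono SUP_upper)
qed

text \<open>Countably many compact subsets of A exhaust it up to a null set of M, and that set is
  also null for the density. Their finite unions increase, so continuity from below gives inner
  regularity of the density.\<close>

lemma radon_measure_density:
  fixes M :: "'a::t2_space measure"
  assumes M: "radon_measure M" and f[measurable]: "f \<in> borel_measurable M"
    and fin: "(\<integral>\<^sup>+x. f x \<partial>M) \<noteq> \<infinity>"
  shows "radon_measure (density M f)"
proof -
  have sets [measurable_cong, simp]: "sets M = sets borel" and "finite_measure M"
    and inner: "\<And>A. A \<in> sets borel \<Longrightarrow> emeasure M A = (SUP C\<in>{C. compact C \<and> C \<subseteq> A}. emeasure M C)"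
    using M by (auto simp: radon_measure_def)
  interpret finite_measure M by fact
  let ?N = "density M f"
  have space [simp]: "space M = UNIV" using sets_eq_imp_space_eq[OF sets] by simp
  have "finite_measure ?N" using fin by (intro finite_measureI) (simp add: emeasure_density)
  moreover have "emeasure ?N A = (SUP C\<in>{C. compact C \<and> C \<subseteq> A}. emeasure ?N C)" if A: "A \<in> sets borel" for A
  proof (rule antisym)
    have "{C. compact C \<and> C \<subseteq> A} \<noteq> {}" by auto
    from ennreal_SUP_countable_SUP[OF this, of "emeasure M"] obtain m :: "nat \<Rightarrow> ennreal"
      where m: "range m \<subseteq> emeasure M ` {C. compact C \<and> C \<subseteq> A}" "emeasure M A = (SUP n. m n)"
      unfolding inner[OF A] by auto
    have "\<exists>C. compact C \<and> C \<subseteq> A \<and> m n = emeasure M C" for n using m(1) by blast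
    then obtain C where C: "\<And>n. compact (C n)" "\<And>n. C n \<subseteq> A" "\<And>n. m n = emeasure M (C n)" by metis
    have Cs: "C n \<in> sets borel" for n using C(1)[of n] by (simp add: compact_imp_closed borel_closed)
    define D where "D n = (\<Union>i\<le>n. C i)" for n
    have D: "compact (D n)" "D n \<subseteq> A" "D n \<in> sets borel" for n
      using C Cs by (auto simp: D_def intro!: compact_UN)
    have incD: "incseq D" by (auto simp: incseq_def D_def intro: order_trans)
    have U: "(\<Union>n. D n) \<in> sets borel" "(\<Union>n. D n) \<subseteq> A" using D by auto
    have "emeasure M A \<le> emeasure M (\<Union>n. D n)"
      unfolding m(2) C(3) using U(1) by (intro SUP_least emeasure_mono) (auto simp: D_def)
    then have "emeasure M (A - (\<Union>n. D n)) = 0"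
      using emeasure_Diff[of M "\<Union>n. D n" A] U A by (auto simp: diff_eq_0_iff_ennreal less_top[symmetric])
    then have null: "A - (\<Union>n. D n) \<in> null_sets M" using U A by (intro null_setsI) auto
    then have "AE x in M. x \<notin> A - (\<Union>n. D n)" by (rule AE_not_in)
    then have "emeasure ?N A = emeasure ?N (\<Union>n. D n)"
      using U A unfolding emeasure_density[OF f, of A, unfolded sets, OF A] emeasure_density[OF f, of "\<Union>n. D n", unfolded sets, OF U(1)]
      by (intro nn_integral_cong_AE) (auto split: split_indicator)
    also have "\<dots> = (SUP n. emeasure ?N (D n))"
      using incD D by (intro SUP_emeasure_incseq[symmetric]) auto
    also have "\<dots> \<le> (SUP C\<in>{C. compact C \<and> C \<subseteq> A}. emeasure ?N C)"
      using D by (intro SUP_mono) auto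
    finally show "emeasure ?N A \<le> (SUP C\<in>{C. compact C \<and> C \<subseteq> A}. emeasure ?N C)" .
    show "(SUP C\<in>{C. compact C \<and> C \<subseteq> A}. emeasure ?N C) \<le> emeasure ?N A"
      using A by (intro SUP_least emeasure_mono) auto
  qed
  ultimately show ?thesis by (simp add: radon_measure_def)
qed

lemma compact_continuous_bounded:
  fixes g :: "'a::topological_space \<Rightarrow> real"
  assumes "compact (UNIV :: 'a set)" "continuous_on UNIV g"
  obtains B where "0 < B" "\<And>x. \<bar>g x\<bar> \<le> B"
proof -
  have "bounded (range g)" using assms by (intro compact_imp_bounded compact_continuous_image)
  then obtain B where "0 < B" "\<forall>x\<in>range g. norm x \<le> B" unfolding bounded_pos by auto
  then show thesis by (intro that[of B]) auto
qed

lemma compact_continuous_integrable: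
  fixes g :: "'a::topological_space \<Rightarrow> real"
  assumes "compact (UNIV :: 'a set)" "continuous_on UNIV g" "sets M = sets borel" "finite_measure M"
  shows "integrable M g"
proof -
  interpret finite_measure M by fact
  obtain B where "\<And>x. \<bar>g x\<bar> \<le> B" using compact_continuous_bounded[OF assms(1,2)] by blast
  then show ?thesis
    using assms(2,3)
    by (intro integrable_const_bound[where B = B])
       (auto simp: measurable_cong_sets[OF assms(3) refl] intro: borel_measurable_continuous_onI)
qed

lemma integrable_mult_continuous:
  fixes g r :: "'a::topological_space \<Rightarrow> real"
  assumes "compact (UNIV :: 'a set)" "continuous_on UNIV g" "sets M = sets borel" "integrable M r"
  shows "integrable M (\<lambda>x. r x * g x)"
proof -
  obtain B where B: "\<And>x. \<bar>g x\<bar> \<le> B" using compact_continuous_bounded[OF assms(1,2)] by blast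
  have [measurable]: "g \<in> borel_measurable M"
    using assms(2,3) by (simp add: measurable_cong_sets[OF assms(3) refl] borel_measurable_continuous_onI)
  have "integrable M (\<lambda>x. B * \<bar>r x\<bar>)" using assms(4) by auto
  then show ?thesis
  proof (rule Bochner_Integration.integrable_bound)
    show "(\<lambda>x. r x * g x) \<in> borel_measurable M" using assms(4) by measurable
    have "norm (r x * g x) \<le> norm (B * \<bar>r x\<bar>)" for x
    proof -
      have "\<bar>r x\<bar> * \<bar>g x\<bar> \<le> \<bar>r x\<bar> * B" using B by (intro mult_left_mono) auto
      also have "\<dots> \<le> \<bar>B * \<bar>r x\<bar>\<bar>" by (simp add: ac_simps)
      finally show ?thesis by (simp add: abs_mult)
    qed
    then show "AE x in M. norm (r x * g x) \<le> norm (B * \<bar>r x\<bar>)" by simp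
  qed
qed

section \<open>Test functions and \<tau>-additive measures\<close>

definition test_fun :: "'a::topological_space set \<Rightarrow> ('a \<Rightarrow> real) set" where
  "test_fun U = {g. continuous_on UNIV g \<and> (\<forall>x. 0 \<le> g x \<and> g x \<le> indicator U x)}"

lemma test_fun_nonempty: "test_fun U \<noteq> {}"
  by (auto simp: test_fun_def intro!: exI[of _ "\<lambda>_. 0"])

lemma test_fun_max: "g \<in> test_fun U \<Longrightarrow> h \<in> test_fun U \<Longrightarrow> (\<lambda>x. max (g x) (h x)) \<in> test_fun U"
  by (auto simp: test_fun_def intro!: continuous_intros simp: le_max_iff_disj)

lemma SUP_test_fun:
  fixes U :: "'a::t2_space set"
  assumes "compact (UNIV :: 'a set)" "open U"
  shows "(SUP g\<in>test_fun U. ennreal (g x)) = indicator U x"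
proof (rule antisym)
  have "ennreal (g x) \<le> indicator U x" if "g \<in> test_fun U" for g
  proof -
    have "g x \<le> indicator U x" using that by (auto simp: test_fun_def)
    then show ?thesis by (auto simp: ennreal_le_1 split: split_indicator_asm) (simp add: ennreal_eq_0_iff)
  qed
  then show "(SUP g\<in>test_fun U. ennreal (g x)) \<le> indicator U x" by (rule SUP_least)
  show "indicator U x \<le> (SUP g\<in>test_fun U. ennreal (g x))"
  proof (cases "x \<in> U")
    case True
    obtain g :: "'a \<Rightarrow> real" where g: "continuous_on UNIV g" "\<And>x. 0 \<le> g x" "\<And>x. g x \<le> 1"
        "g x = 1" "\<And>x. x \<notin> U \<Longrightarrow> g x = 0"
      using compact_t2_Urysohn[of "{x}" U] assms True by auto
    then have "g \<in> test_fun U" by (auto simp: test_fun_def split: split_indicator)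
    from SUP_upper[OF this, of "\<lambda>g. ennreal (g x)"] show ?thesis using g(4) True by simp
  qed simp
qed

text \<open>Such measures are determined by their integrals of continuous functions; unlike inner
  regularity, the property passes easily to mixtures of weakly continuous families.\<close>

definition tau_measure :: "'a::topological_space measure \<Rightarrow> bool" where
  "tau_measure M \<longleftrightarrow> sets M = sets borel \<and> finite_measure M \<and>
     (\<forall>U. open U \<longrightarrow> emeasure M U = (SUP g\<in>test_fun U. ennreal (\<integral>x. g x \<partial>M)))"

text \<open>The test functions of U are directed upwards with supremum the indicator of U. The
  family may be uncountable, so \<open>radon_nn_integral_directed_SUP\<close> takes the place of
  monotone convergence.\<close>

lemma radon_imp_tau_measure:
  fixes M :: "'a::t2_space measure"
  assumes K: "compact (UNIV :: 'a set)" and M: "radon_measure M"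
  shows "tau_measure M"
proof -
  have sets: "sets M = sets borel" and fin: "finite_measure M" using M by (auto simp: radon_measure_def)
  have "emeasure M U = (SUP g\<in>test_fun U. ennreal (\<integral>x. g x \<partial>M))" if U: "open U" for U
  proof -
    have "emeasure M U = (\<integral>\<^sup>+x. (SUP g\<in>test_fun U. ennreal (g x)) \<partial>M)"
      using U by (simp add: SUP_test_fun[OF K U] sets)
    also have "\<dots> = (SUP g\<in>test_fun U. \<integral>\<^sup>+x. ennreal (g x) \<partial>M)"
    proof (rule radon_nn_integral_directed_SUP[OF M _ test_fun_nonempty])
      fix g h assume gh: "g \<in> test_fun U" "h \<in> test_fun U"
      show "\<exists>k\<in>test_fun U. (\<lambda>x. ennreal (g x)) \<le> (\<lambda>x. ennreal (k x)) \<and> (\<lambda>x. ennreal (h x)) \<le> (\<lambda>x. ennreal (k x))"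
        by (rule bexI[OF _ test_fun_max[OF gh]]) (auto simp: le_fun_def intro!: ennreal_leI)
    next
      fix g t assume "g \<in> test_fun U"
      then show "open {x. t < ennreal (g x)}"
        by (intro open_Collect_less continuous_on_const continuous_on_ennreal) (auto simp: test_fun_def)
    qed
    also have "\<dots> = (SUP g\<in>test_fun U. ennreal (\<integral>x. g x \<partial>M))"
      by (intro SUP_cong refl nn_integral_eq_integral compact_continuous_integrable[OF K _ sets fin])
         (auto simp: test_fun_def)
    finally show ?thesis .
  qed
  then show ?thesis using sets fin by (simp add: tau_measure_def)
qed

lemma borel_eq_sigma_sets_open: "sets (borel :: 'a::topological_space measure) = sigma_sets UNIV {U. open U}"
  by (simp add: borel_def)

text \<open>Integrals of test functions fix the values on open sets, and these form an
  intersection-stable generator of the Borel sets.\<close>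

lemma tau_measure_eqI:
  fixes M N :: "'a::topological_space measure"
  assumes M: "tau_measure M" and N: "tau_measure N"
    and eq: "\<And>g :: 'a \<Rightarrow> real. continuous_on UNIV g \<Longrightarrow> (\<integral>x. g x \<partial>M) = (\<integral>x. g x \<partial>N)"
  shows "M = N"
proof (rule measure_eqI_generator_eq[where E = "{U. open U}" and \<Omega> = UNIV and A = "\<lambda>_. UNIV"])
  show "Int_stable {U::'a set. open U}" by (auto simp: Int_stable_def)
  interpret finite_measure M using M by (simp add: tau_measure_def)
  fix U :: "'a set" assume "U \<in> {U. open U}"
  then have "emeasure M U = (SUP g\<in>test_fun U. ennreal (\<integral>x. g x \<partial>M))"
    using M by (simp add: tau_measure_def)
  also have "\<dots> = (SUP g\<in>test_fun U. ennreal (\<integral>x. g x \<partial>N))"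
    by (intro SUP_cong refl arg_cong[where f = ennreal] eq) (auto simp: test_fun_def)
  also have "\<dots> = emeasure N U"
    using N \<open>U \<in> _\<close> by (simp add: tau_measure_def)
  finally show "emeasure M U = emeasure N U" .
next
  interpret finite_measure M using M by (simp add: tau_measure_def)
  show "emeasure M UNIV \<noteq> \<infinity>" by simp
qed (use M N in \<open>auto simp: tau_measure_def borel_eq_sigma_sets_open\<close>)

section \<open>Weakly continuous kernels and their mixtures\<close>

text \<open>The fibres are asked to be \<tau>-measures and not Radon measures, so that the notion
  also covers \<open>transition\<close>, a mixture for which only \<tau>-additivity is
  established.\<close>

definition weakly_continuous_kernel :: "('b::topological_space \<Rightarrow> 'a::topological_space measure) \<Rightarrow> bool" where
  "weakly_continuous_kernel \<kappa> \<longleftrightarrow> (\<forall>z. prob_space (\<kappa> z) \<and> tau_measure (\<kappa> z)) \<and>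
     (\<forall>g :: 'a \<Rightarrow> real. continuous_on UNIV g \<longrightarrow> continuous_on UNIV (\<lambda>z. \<integral>u. g u \<partial>\<kappa> z))"

lemma lower_semicontinuous_SUP:
  assumes "\<And>i. i \<in> I \<Longrightarrow> continuous_on UNIV (f i :: 'b::topological_space \<Rightarrow> real)"
  shows "open {z. t < (SUP i\<in>I. ennreal (f i z))}"
proof -
  have "{z. t < (SUP i\<in>I. ennreal (f i z))} = (\<Union>i\<in>I. {z. t < ennreal (f i z)})"
    by (auto simp: less_SUP_iff)
  then show ?thesis
    using assms by (auto intro!: open_UN open_Collect_less continuous_on_const continuous_on_ennreal)
qed

text \<open>For open U the mass of U is a supremum of continuous functions of z, hence lower
  semicontinuous and Borel; the open sets generate the rest.\<close>

lemma weakly_continuous_kernel_measurable: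
  assumes \<kappa>: "weakly_continuous_kernel \<kappa>"
  shows "\<kappa> \<in> borel \<rightarrow>\<^sub>M subprob_algebra borel"
proof (rule measurable_subprob_algebra_generated[OF borel_eq_sigma_sets_open])
  show "Int_stable {U. open U}" by (auto simp: Int_stable_def)
  show "subprob_space (\<kappa> z)" for z
    using \<kappa> by (auto simp: weakly_continuous_kernel_def intro: prob_space_imp_subprob_space)
  have meas: "(\<lambda>z. emeasure (\<kappa> z) U) \<in> borel_measurable borel" if "open U" for U
  proof (rule borel_measurableI_greater)
    fix t
    have "emeasure (\<kappa> z) U = (SUP g\<in>test_fun U. ennreal (\<integral>u. g u \<partial>\<kappa> z))" for z
      using \<kappa> that by (auto simp: weakly_continuous_kernel_def tau_measure_def)
    moreover have "open {z. t < (SUP g\<in>test_fun U. ennreal (\<integral>u. g u \<partial>\<kappa> z))}"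
      using \<kappa> by (intro lower_semicontinuous_SUP) (auto simp: weakly_continuous_kernel_def test_fun_def)
    ultimately show "{z \<in> space borel. t < emeasure (\<kappa> z) U} \<in> sets borel" by simp
  qed
  show "(\<lambda>z. emeasure (\<kappa> z) U) \<in> borel_measurable borel" if "U \<in> {U. open U}" for U
    using meas that by simp
  show "(\<lambda>z. emeasure (\<kappa> z) UNIV) \<in> borel_measurable borel" by (rule meas) simp
qed (use \<kappa> in \<open>auto simp: weakly_continuous_kernel_def tau_measure_def\<close>)

text \<open>Apply \<open>nn_integral_bind\<close> to the norm of f: a finite double integral has an
  almost everywhere finite inner integral, and it dominates the norm of the iterated Bochner
  integral.\<close>

lemma integrable_bind:
  fixes f :: "'b \<Rightarrow> 'c::{banach, second_countable_topology}"
  assumes N[measurable]: "N \<in> M \<rightarrow>\<^sub>M subprob_algebra B" and f[measurable]: "f \<in> borel_measurable B"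
    and int: "integrable (M \<bind> N) f"
  shows "AE x in M. integrable (N x) f" "integrable M (\<lambda>x. \<integral>y. f y \<partial>N x)"
proof -
  have fin: "(\<integral>\<^sup>+x. \<integral>\<^sup>+y. norm (f y) \<partial>N x \<partial>M) < \<infinity>"
    using int N by (subst nn_integral_bind[OF _ N, symmetric]) (auto simp: integrable_iff_bounded)
  have "AE x in M. (\<integral>\<^sup>+y. norm (f y) \<partial>N x) \<noteq> \<infinity>"
    using fin by (intro nn_integral_PInf_AE) auto
  then show ae: "AE x in M. integrable (N x) f"
  proof (rule AE_mp[OF _ AE_I2], intro impI)
    fix x assume x: "x \<in> space M" and "(\<integral>\<^sup>+y. norm (f y) \<partial>N x) \<noteq> \<infinity>"
    then show "integrable (N x) f"
      by (intro integrableI_bounded)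
         (auto simp: less_top measurable_cong_sets[OF sets_kernel[OF N x] refl])
  qed
  show "integrable M (\<lambda>x. \<integral>y. f y \<partial>N x)"
  proof (rule integrableI_bounded)
    have "(\<integral>\<^sup>+x. norm (\<integral>y. f y \<partial>N x) \<partial>M) \<le> (\<integral>\<^sup>+x. \<integral>\<^sup>+y. norm (f y) \<partial>N x \<partial>M)"
      using ae by (intro nn_integral_mono_AE) (auto intro: integral_norm_bound_ennreal)
    then show "(\<integral>\<^sup>+x. norm (\<integral>y. f y \<partial>N x) \<partial>M) < \<infinity>" using fin by (rule le_less_trans)
  qed measurable
qed

lemma integral_bind_nonneg:
  fixes f :: "'b \<Rightarrow> real"
  assumes N[measurable]: "N \<in> M \<rightarrow>\<^sub>M subprob_algebra B" and f[measurable]: "f \<in> borel_measurable B"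
    and int: "integrable (M \<bind> N) f" and nonneg: "\<And>y. 0 \<le> f y"
  shows "(\<integral>x. (\<integral>y. f y \<partial>N x) \<partial>M) = (\<integral>y. f y \<partial>(M \<bind> N))"
proof -
  have "ennreal (\<integral>y. f y \<partial>(M \<bind> N)) = (\<integral>\<^sup>+y. f y \<partial>(M \<bind> N))"
    using int nonneg by (intro nn_integral_eq_integral[symmetric]) auto
  also have "\<dots> = (\<integral>\<^sup>+x. \<integral>\<^sup>+y. f y \<partial>N x \<partial>M)" by (subst nn_integral_bind[OF _ N]) auto
  also have "\<dots> = (\<integral>\<^sup>+x. ennreal (\<integral>y. f y \<partial>N x) \<partial>M)"
    using integrable_bind(1)[OF N f int] nonneg
    by (intro nn_integral_cong_AE) (auto intro!: nn_integral_eq_integral)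
  also have "\<dots> = ennreal (\<integral>x. (\<integral>y. f y \<partial>N x) \<partial>M)"
    using integrable_bind(2)[OF N f int] nonneg by (intro nn_integral_eq_integral) auto
  finally show ?thesis using nonneg by (simp add: ennreal_inj)
qed

lemma integral_bind_real:
  fixes f :: "'b \<Rightarrow> real"
  assumes N[measurable]: "N \<in> M \<rightarrow>\<^sub>M subprob_algebra B" and f[measurable]: "f \<in> borel_measurable B"
    and int: "integrable (M \<bind> N) f"
  shows "(\<integral>x. (\<integral>y. f y \<partial>N x) \<partial>M) = (\<integral>y. f y \<partial>(M \<bind> N))"
proof -
  let ?p = "\<lambda>y. max 0 (f y)" and ?n = "\<lambda>y. max 0 (- f y)"
  have split: "f = (\<lambda>y. ?p y - ?n y)" by (auto simp: fun_eq_iff max_def)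
  have i: "integrable (M \<bind> N) ?p" "integrable (M \<bind> N) ?n" using int by auto
  \<comment> \<open>The inner integral may be split only for those x at which both parts are
    integrable under \<open>N x\<close>, that is, for almost every x.\<close>
  have "(\<integral>x. (\<integral>y. f y \<partial>N x) \<partial>M) = (\<integral>x. (\<integral>y. ?p y \<partial>N x) - (\<integral>y. ?n y \<partial>N x) \<partial>M)"
  proof (rule integral_cong_AE)
    show "AE x in M. (\<integral>y. f y \<partial>N x) = (\<integral>y. ?p y \<partial>N x) - (\<integral>y. ?n y \<partial>N x)"
      using integrable_bind(1)[OF N _ i(1)] integrable_bind(1)[OF N _ i(2)]
      by (subst split) auto
  qed measurable
  also have "\<dots> = (\<integral>x. (\<integral>y. ?p y \<partial>N x) \<partial>M) - (\<integral>x. (\<integral>y. ?n y \<partial>N x) \<partial>M)"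
    using integrable_bind(2)[OF N _ i(1)] integrable_bind(2)[OF N _ i(2)]
    by (intro Bochner_Integration.integral_diff) auto
  also have "\<dots> = (\<integral>y. ?p y \<partial>(M \<bind> N)) - (\<integral>y. ?n y \<partial>(M \<bind> N))"
    using i by (simp add: integral_bind_nonneg[OF N])
  also have "\<dots> = (\<integral>y. f y \<partial>(M \<bind> N))"
    using i by (subst Bochner_Integration.integral_diff[symmetric]) (auto simp: split[symmetric])
  finally show ?thesis .
qed

lemma integral_bind_complex:
  fixes f :: "'b \<Rightarrow> complex"
  assumes N[measurable]: "N \<in> M \<rightarrow>\<^sub>M subprob_algebra B" and f[measurable]: "f \<in> borel_measurable B"
    and int: "integrable (M \<bind> N) f"
  shows "(\<integral>x. (\<integral>y. f y \<partial>N x) \<partial>M) = (\<integral>y. f y \<partial>(M \<bind> N))"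
proof (rule complex_eqI)
  note ae = integrable_bind(1)[OF N f int] and i = integrable_bind(2)[OF N f int]
  have "Re (\<integral>x. (\<integral>y. f y \<partial>N x) \<partial>M) = (\<integral>x. Re (\<integral>y. f y \<partial>N x) \<partial>M)"
    using i by simp
  also have "\<dots> = (\<integral>x. (\<integral>y. Re (f y) \<partial>N x) \<partial>M)"
    using ae by (intro integral_cong_AE) auto
  also have "\<dots> = Re (\<integral>y. f y \<partial>(M \<bind> N))"
    using int by (subst integral_bind_real[OF N]) auto
  finally show "Re (\<integral>x. (\<integral>y. f y \<partial>N x) \<partial>M) = Re (\<integral>y. f y \<partial>(M \<bind> N))" .
  have "Im (\<integral>x. (\<integral>y. f y \<partial>N x) \<partial>M) = (\<integral>x. Im (\<integral>y. f y \<partial>N x) \<partial>M)"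
    using i by simp
  also have "\<dots> = (\<integral>x. (\<integral>y. Im (f y) \<partial>N x) \<partial>M)"
    using ae by (intro integral_cong_AE) auto
  also have "\<dots> = Im (\<integral>y. f y \<partial>(M \<bind> N))"
    using int by (subst integral_bind_real[OF N]) auto
  finally show "Im (\<integral>x. (\<integral>y. f y \<partial>N x) \<partial>M) = Im (\<integral>y. f y \<partial>(M \<bind> N))" .
qed

text \<open>The mass that \<kappa> x gives to an open U is a directed supremum of integrals of test
  functions, which are continuous in x. Inner regularity of M moves this supremum out of the
  integral over x, so M has to be Radon while the fibres are only \<tau>-measures.\<close>

lemma tau_measure_bind:
  fixes \<kappa> :: "'a::t2_space \<Rightarrow> 'a measure" and g :: "'a \<Rightarrow> real"
  assumes K: "compact (UNIV :: 'a set)" and M: "radon_measure M" and \<kappa>: "weakly_continuous_kernel \<kappa>"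
  shows "tau_measure (M \<bind> \<kappa>)"
    and "continuous_on UNIV g \<Longrightarrow> (\<integral>x. g x \<partial>(M \<bind> \<kappa>)) = (\<integral>x. (\<integral>u. g u \<partial>\<kappa> x) \<partial>M)"
proof -
  have sets: "sets M = sets borel" and fin: "finite_measure M" using M by (auto simp: radon_measure_def)
  have space: "space M = UNIV" using sets_eq_imp_space_eq[OF sets] by simp
  interpret finite_measure M by fact
  have km: "\<kappa> \<in> M \<rightarrow>\<^sub>M subprob_algebra borel"
    using weakly_continuous_kernel_measurable[OF \<kappa>] by (simp add: measurable_cong_sets[OF sets refl])
  have k: "prob_space (\<kappa> z)" "sets (\<kappa> z) = sets borel" "finite_measure (\<kappa> z)" for z
    using \<kappa> by (auto simp: weakly_continuous_kernel_def tau_measure_def)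
  have kc: "continuous_on UNIV (\<lambda>z. \<integral>u. g u \<partial>\<kappa> z)" if "continuous_on UNIV g" for g :: "'a \<Rightarrow> real"
    using \<kappa> that by (auto simp: weakly_continuous_kernel_def)
  have bs: "sets (M \<bind> \<kappa>) = sets borel" using k space by (intro sets_bind) auto
  have bsp: "space (M \<bind> \<kappa>) = UNIV" using sets_eq_imp_space_eq[OF bs] by simp
  have kU: "emeasure (\<kappa> z) UNIV = 1" for z
    using prob_space.emeasure_space_1[OF k(1)[of z]] sets_eq_imp_space_eq[OF k(2)[of z]] by simp
  have bf: "finite_measure (M \<bind> \<kappa>)"
    using space by (intro finite_measureI) (simp add: bsp emeasure_bind[OF _ km] kU)
  have int: "(\<integral>x. g x \<partial>(M \<bind> \<kappa>)) = (\<integral>x. (\<integral>u. g u \<partial>\<kappa> x) \<partial>M)" if g: "continuous_on UNIV g" for g :: "'a \<Rightarrow> real"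
    by (rule integral_bind_real[OF km, symmetric])
       (use g compact_continuous_integrable[OF K g bs bf] in \<open>auto intro: borel_measurable_continuous_onI\<close>)
  show "continuous_on UNIV g \<Longrightarrow> (\<integral>x. g x \<partial>(M \<bind> \<kappa>)) = (\<integral>x. (\<integral>u. g u \<partial>\<kappa> x) \<partial>M)"
    by (rule int)
  have "emeasure (M \<bind> \<kappa>) U = (SUP g\<in>test_fun U. ennreal (\<integral>x. g x \<partial>(M \<bind> \<kappa>)))" if U: "open U" for U
  proof -
    have "emeasure (M \<bind> \<kappa>) U = (\<integral>\<^sup>+x. emeasure (\<kappa> x) U \<partial>M)"
      using space U by (intro emeasure_bind[OF _ km]) auto
    also have "\<dots> = (\<integral>\<^sup>+x. (SUP g\<in>test_fun U. ennreal (\<integral>u. g u \<partial>\<kappa> x)) \<partial>M)"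
      using \<kappa> U by (auto simp: weakly_continuous_kernel_def tau_measure_def)
    also have "\<dots> = (SUP g\<in>test_fun U. \<integral>\<^sup>+x. ennreal (\<integral>u. g u \<partial>\<kappa> x) \<partial>M)"
    proof (rule radon_nn_integral_directed_SUP[OF M _ test_fun_nonempty])
      fix g h assume gh: "g \<in> test_fun U" "h \<in> test_fun U"
      then have c: "integrable (\<kappa> x) g" "integrable (\<kappa> x) h" "integrable (\<kappa> x) (\<lambda>u. max (g u) (h u))" for x
        by (auto intro!: compact_continuous_integrable[OF K _ k(2,3)] continuous_intros simp: test_fun_def)
      show "\<exists>l\<in>test_fun U. (\<lambda>x. ennreal (\<integral>u. g u \<partial>\<kappa> x)) \<le> (\<lambda>x. ennreal (\<integral>u. l u \<partial>\<kappa> x)) \<and>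
               (\<lambda>x. ennreal (\<integral>u. h u \<partial>\<kappa> x)) \<le> (\<lambda>x. ennreal (\<integral>u. l u \<partial>\<kappa> x))"
        by (rule bexI[OF _ test_fun_max[OF gh]])
           (auto simp: le_fun_def intro!: ennreal_leI integral_mono c)
    next
      fix g t assume "g \<in> test_fun U"
      then show "open {x. t < ennreal (\<integral>u. g u \<partial>\<kappa> x)}"
        by (intro open_Collect_less continuous_on_const continuous_on_ennreal kc) (auto simp: test_fun_def)
    qed
    also have "\<dots> = (SUP g\<in>test_fun U. ennreal (\<integral>x. g x \<partial>(M \<bind> \<kappa>)))"
    proof (intro SUP_cong refl)
      fix g assume g: "g \<in> test_fun U"
      then have gc: "continuous_on UNIV g" by (simp add: test_fun_def)
      show "(\<integral>\<^sup>+x. ennreal (\<integral>u. g u \<partial>\<kappa> x) \<partial>M) = ennreal (\<integral>x. g x \<partial>(M \<bind> \<kappa>))"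
        unfolding int[OF gc] using g
        by (intro nn_integral_eq_integral compact_continuous_integrable[OF K _ sets fin] kc gc)
           (auto simp: test_fun_def)
    qed
    finally show ?thesis .
  qed
  then show "tau_measure (M \<bind> \<kappa>)" using bs bf by (simp add: tau_measure_def)
qed

section \<open>Fubini's theorem and parameter integrals for continuous integrands\<close>

lemma continuous_on_compose_pair:
  assumes "continuous_on UNIV (\<lambda>(x, y). G x y)" "continuous_on UNIV f" "continuous_on UNIV g"
  shows "continuous_on UNIV (\<lambda>z. G (f z) (g z))"
  using continuous_on_compose2[OF assms(1) continuous_on_Pair[OF assms(2,3)]] by simp

lemma compact_t2_separate_points:
  fixes x y :: "'a::t2_space"
  assumes K: "compact (UNIV :: 'a set)" and "x \<noteq> y"
  obtains g :: "'a \<Rightarrow> real" where "continuous_on UNIV g" "g x = 1" "g y = 0"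
proof (rule compact_t2_Urysohn[OF K, of "{x}" "- {y}"])
  fix g :: "'a \<Rightarrow> real"
  assume "continuous_on UNIV g" "\<And>z. z \<in> {x} \<Longrightarrow> g z = 1" "\<And>z. z \<notin> - {y} \<Longrightarrow> g z = 0"
  then show thesis by (intro that[of g]) auto
qed (use assms in auto)

text \<open>The product of the two Borel algebras may be smaller than the Borel algebra of the product,
  so joint measurability of a continuous function needs the Stone-Weierstrass theorem.\<close>

lemma continuous_borel_measurable_pair:
  fixes G :: "'a::t2_space \<times> 'b::t2_space \<Rightarrow> real"
  assumes K: "compact (UNIV :: 'a set)" "compact (UNIV :: 'b set)" and G: "continuous_on UNIV G"
  shows "G \<in> borel_measurable (borel \<Otimes>\<^sub>M borel)"
proof -
  let ?P = "\<lambda>f :: 'a \<times> 'b \<Rightarrow> real. continuous_on UNIV f \<and> f \<in> borel_measurable (borel \<Otimes>\<^sub>M borel)"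
  have ex: "\<exists>g. ?P g \<and> (\<forall>z\<in>UNIV. \<bar>G z - g z\<bar> < e)" if "0 < e" for e
  proof (rule Stone_Weierstrass_HOL[where P = ?P])
    show "compact (UNIV :: ('a \<times> 'b) set)" using compact_Times[OF K] by simp
    \<comment> \<open>A continuous function of one coordinate is measurable for the product algebra,
      and two distinct pairs differ in some coordinate.\<close>
    show "\<exists>f. ?P f \<and> f x \<noteq> f y" if "x \<in> UNIV \<and> y \<in> UNIV \<and> x \<noteq> y" for x y
    proof (cases "fst x = fst y")
      case False
      obtain g :: "'a \<Rightarrow> real" where g: "continuous_on UNIV g" "g (fst x) = 1" "g (fst y) = 0"
        using compact_t2_separate_points[OF K(1) False] .
      have [measurable]: "g \<in> borel_measurable borel" using g(1) by (rule borel_measurable_continuous_onI)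
      show ?thesis
        using g by (intro exI[of _ "\<lambda>z. g (fst z)"])
          (auto intro!: continuous_on_compose2[OF g(1)] continuous_intros)
    next
      case True
      with that have ne: "snd x \<noteq> snd y" by (auto simp: prod_eq_iff)
      obtain g :: "'b \<Rightarrow> real" where g: "continuous_on UNIV g" "g (snd x) = 1" "g (snd y) = 0"
        using compact_t2_separate_points[OF K(2) ne] .
      have [measurable]: "g \<in> borel_measurable borel" using g(1) by (rule borel_measurable_continuous_onI)
      show ?thesis
        using g by (intro exI[of _ "\<lambda>z. g (snd z)"])
          (auto intro!: continuous_on_compose2[OF g(1)] continuous_intros)
    qed
  qed (use G \<open>0 < e\<close> in \<open>auto intro!: continuous_intros\<close>)
  have "\<exists>g. ?P g \<and> (\<forall>z. \<bar>G z - g z\<bar> < inverse (real (Suc n)))" for n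
    using ex[of "inverse (real (Suc n))"] by (simp del: of_nat_Suc)
  then obtain g where g: "\<And>n. g n \<in> borel_measurable (borel \<Otimes>\<^sub>M borel)"
      "\<And>n z. \<bar>G z - g n z\<bar> < inverse (real (Suc n))" by metis
  show ?thesis
  proof (rule borel_measurable_LIMSEQ_real[OF _ g(1)])
    fix z
    have "norm (g n z - G z) \<le> inverse (real (Suc n))" for n
      using g(2)[of z n] by (simp add: abs_minus_commute)
    then have "(\<lambda>n. g n z - G z) \<longlonglongrightarrow> 0"
      by (intro Lim_null_comparison[OF _ LIMSEQ_inverse_real_of_nat] always_eventually) blast
    then show "(\<lambda>n. g n z) \<longlonglongrightarrow> G z" by (simp add: LIM_zero_iff)
  qed
qed

text \<open>The weight \<open>r\<close> admits a merely integrable factor in one variable, such as a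
  harmonic function. Since G is bounded, a multiple of the absolute value of \<open>r\<close>
  dominates the product.\<close>

lemma Fubini_continuous:
  fixes G :: "'a::t2_space \<Rightarrow> 'b::t2_space \<Rightarrow> real"
  assumes K: "compact (UNIV :: 'a set)" "compact (UNIV :: 'b set)"
    and M: "sets M = sets borel" "finite_measure M" and N: "sets N = sets borel" "finite_measure N"
    and G: "continuous_on UNIV (\<lambda>(x, y). G x y)" and r: "integrable M r"
  shows "(\<integral>x. r x * (\<integral>y. G x y \<partial>N) \<partial>M) = (\<integral>y. (\<integral>x. r x * G x y \<partial>M) \<partial>N)"
proof -
  interpret M: finite_measure M by fact
  interpret N: finite_measure N by fact
  interpret pair_sigma_finite M N ..
  have s: "sets (M \<Otimes>\<^sub>M N) = sets (borel \<Otimes>\<^sub>M borel)" using M N by (intro sets_pair_measure_cong)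
  have [measurable]: "(\<lambda>(x, y). G x y) \<in> borel_measurable (M \<Otimes>\<^sub>M N)"
    using continuous_borel_measurable_pair[OF K G] by (simp add: measurable_cong_sets[OF s refl])
  have [measurable]: "r \<in> borel_measurable M" using r by simp
  have "compact (UNIV :: ('a \<times> 'b) set)" using compact_Times[OF K] by simp
  from compact_continuous_bounded[OF this G] obtain B
    where B': "0 < B" "\<And>z. \<bar>case z of (x, y) \<Rightarrow> G x y\<bar> \<le> B" by blast
  have B: "\<bar>G x y\<bar> \<le> B" "0 < B" for x y using B'(1) B'(2)[of "(x, y)"] by auto
  have "integrable (M \<Otimes>\<^sub>M N) (\<lambda>(x, y). r x * G x y)"
  proof (rule Fubini_integrable)
    show "(\<lambda>(x, y). r x * G x y) \<in> borel_measurable (M \<Otimes>\<^sub>M N)"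
    proof -
      have "(\<lambda>z. r (fst z) * (\<lambda>(x, y). G x y) z) \<in> borel_measurable (M \<Otimes>\<^sub>M N)" by measurable
      then show ?thesis by (simp add: case_prod_beta')
    qed
    have Gy: "integrable N (G x)" for x
      by (intro compact_continuous_integrable[OF K(2) _ N])
         (rule continuous_on_compose_pair[OF G]; intro continuous_intros)
    have Gm: "(\<lambda>x. \<integral>y. \<bar>G x y\<bar> \<partial>N) \<in> borel_measurable M"
      by (rule N.borel_measurable_lebesgue_integral)
         (use \<open>(\<lambda>(x, y). G x y) \<in> borel_measurable (M \<Otimes>\<^sub>M N)\<close> in \<open>auto simp: case_prod_beta'\<close>)
    have bound: "\<bar>\<integral>y. \<bar>G x y\<bar> \<partial>N\<bar> \<le> B * measure N (space N)" for x
    proof -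
      have "(\<integral>y. \<bar>G x y\<bar> \<partial>N) \<le> (\<integral>y. B \<partial>N)"
        using Gy B by (intro integral_mono) auto
      then show ?thesis by (simp add: ac_simps)
    qed
    show "integrable M (\<lambda>x. \<integral>y. norm (case (x, y) of (x, y) \<Rightarrow> r x * G x y) \<partial>N)"
    proof (rule Bochner_Integration.integrable_bound)
      show "integrable M (\<lambda>x. (B * measure N (space N)) * \<bar>r x\<bar>)" using r by auto
      show "(\<lambda>x. \<integral>y. norm (case (x, y) of (x, y) \<Rightarrow> r x * G x y) \<partial>N) \<in> borel_measurable M"
        using Gm by (simp add: abs_mult)
      show "AE x in M. norm (\<integral>y. norm (case (x, y) of (x, y) \<Rightarrow> r x * G x y) \<partial>N)
              \<le> norm ((B * measure N (space N)) * \<bar>r x\<bar>)"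
      proof (intro AE_I2)
        fix x
        have "\<bar>r x\<bar> * \<bar>\<integral>y. \<bar>G x y\<bar> \<partial>N\<bar> \<le> \<bar>r x\<bar> * (B * measure N (space N))"
          using bound by (intro mult_left_mono) auto
        then show "norm (\<integral>y. norm (case (x, y) of (x, y) \<Rightarrow> r x * G x y) \<partial>N)
            \<le> norm ((B * measure N (space N)) * \<bar>r x\<bar>)"
          using B(2) by (simp add: abs_mult ac_simps)
      qed
    qed
    show "AE x in M. integrable N (\<lambda>y. case (x, y) of (x, y) \<Rightarrow> r x * G x y)"
      using Gy by simp
  qed
  from Fubini_integral[OF this] show ?thesis by simp
qed

lemma Fubini_continuous':
  fixes G :: "'a::t2_space \<Rightarrow> 'b::t2_space \<Rightarrow> real"
  assumes K: "compact (UNIV :: 'a set)" "compact (UNIV :: 'b set)"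
    and M: "sets M = sets borel" "finite_measure M" and N: "sets N = sets borel" "finite_measure N"
    and G: "continuous_on UNIV (\<lambda>(x, y). G x y)"
  shows "(\<integral>x. (\<integral>y. G x y \<partial>N) \<partial>M) = (\<integral>y. (\<integral>x. G x y \<partial>M) \<partial>N)"
  using Fubini_continuous[OF K M N G, of "\<lambda>_. 1"] M(2) by (simp add: finite_measure.integrable_const)

lemma continuous_on_UNIV_realI:
  fixes f :: "'a::topological_space \<Rightarrow> real"
  assumes "\<And>x0 e. 0 < e \<Longrightarrow> \<exists>X. open X \<and> x0 \<in> X \<and> (\<forall>x\<in>X. \<bar>f x - f x0\<bar> \<le> e)"
  shows "continuous_on UNIV f"
  unfolding continuous_on_def
proof (intro ballI tendstoI)
  fix x0 :: 'a and e :: real assume "0 < e"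
  then obtain X where "open X" "x0 \<in> X" "\<forall>x\<in>X. \<bar>f x - f x0\<bar> \<le> e / 2" using assms[of "e/2" x0] by auto
  then have "dist (f x) (f x0) < e" if "x \<in> X" for x
    using \<open>0 < e\<close> bspec[OF \<open>\<forall>x\<in>X. _\<close> that] by (simp add: dist_real_def)
  with \<open>open X\<close> \<open>x0 \<in> X\<close> show "\<forall>\<^sub>F x in at x0 within UNIV. dist (f x) (f x0) < e"
    unfolding eventually_at_topological by blast
qed

lemma uniform_in_compact_factor:
  fixes G :: "'s::topological_space \<Rightarrow> 'a::topological_space \<Rightarrow> real"
  assumes "compact (UNIV :: 'a set)" "continuous_on UNIV (\<lambda>(s, u). G s u)" "0 < e"
  obtains X where "open X" "s0 \<in> X" "\<And>s u. s \<in> X \<Longrightarrow> \<bar>G s u - G s0 u\<bar> \<le> e"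
proof -
  have "continuous_on (UNIV \<times> UNIV) (\<lambda>(s, u). G s u)" using assms(2) by simp
  from continuous_on_prod_compactE[OF this assms(1) UNIV_I assms(3), of s0]
  obtain X where "s0 \<in> X" "open X"
    and *: "\<forall>s\<in>X \<inter> UNIV. \<forall>u\<in>UNIV. dist (case (s, u) of (s, u) \<Rightarrow> G s u) (case (s0, u) of (s, u) \<Rightarrow> G s u) \<le> e"
    by blast
  then show thesis by (intro that[of X]) (auto simp: dist_real_def)
qed

text \<open>Compactness in \<open>u\<close> makes the convergence of \<open>G s\<close> to
  \<open>G s0\<close> uniform, so the integral changes by at most that uniform distance times the
  \<open>L^1\<close> norm of \<open>r\<close>.\<close>

lemma continuous_on_weighted_integral:
  fixes G :: "'s::topological_space \<Rightarrow> 'a::topological_space \<Rightarrow> real"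
  assumes K: "compact (UNIV :: 'a set)" and G: "continuous_on UNIV (\<lambda>(s, u). G s u)"
    and M: "sets M = sets borel" and r: "integrable M r"
  shows "continuous_on UNIV (\<lambda>s. \<integral>u. r u * G s u \<partial>M)"
proof (rule continuous_on_UNIV_realI)
  fix s0 and e :: real assume e: "0 < e"
  \<comment> \<open>Adding 1 keeps the divisor positive when \<open>r\<close> vanishes almost
    everywhere.\<close>
  define c where "c = (\<integral>u. \<bar>r u\<bar> \<partial>M) + 1"
  have c: "c > 0" "(\<integral>u. \<bar>r u\<bar> \<partial>M) \<le> c"
    using Bochner_Integration.integral_nonneg[of M "\<lambda>u. \<bar>r u\<bar>"] unfolding c_def by linarith+
  have "0 < e / c" using e c by simp
  from uniform_in_compact_factor[OF K G this, of s0] obtain X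
    where X: "open X" "s0 \<in> X" "\<And>s u. s \<in> X \<Longrightarrow> \<bar>G s u - G s0 u\<bar> \<le> e / c" by blast
  have i: "integrable M (\<lambda>u. r u * G s u)" for s
    by (intro integrable_mult_continuous[OF K _ M r])
       (rule continuous_on_compose_pair[OF G]; intro continuous_intros)
  have "\<bar>(\<integral>u. r u * G s u \<partial>M) - (\<integral>u. r u * G s0 u \<partial>M)\<bar> \<le> e" if "s \<in> X" for s
  proof -
    have "\<bar>(\<integral>u. r u * G s u \<partial>M) - (\<integral>u. r u * G s0 u \<partial>M)\<bar> = \<bar>\<integral>u. r u * G s u - r u * G s0 u \<partial>M\<bar>"
      using i by simp
    also have "\<dots> \<le> (\<integral>u. \<bar>r u * G s u - r u * G s0 u\<bar> \<partial>M)" by (rule integral_abs_bound)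
    also have "\<dots> \<le> (\<integral>u. \<bar>r u\<bar> * (e / c) \<partial>M)"
    proof (rule integral_mono)
      show "\<bar>r u * G s u - r u * G s0 u\<bar> \<le> \<bar>r u\<bar> * (e / c)" for u
        using X(3)[OF that, of u]
        by (simp only: right_diff_distrib[symmetric] abs_mult) (rule mult_left_mono, auto)
    qed (use i r in auto)
    also have "\<dots> = (\<integral>u. \<bar>r u\<bar> \<partial>M) * (e / c)" by simp
    also have "\<dots> \<le> c * (e / c)" using c e by (intro mult_right_mono) auto
    finally show ?thesis using c by simp
  qed
  then show "\<exists>X. open X \<and> s0 \<in> X \<and> (\<forall>s\<in>X. \<bar>(\<integral>u. r u * G s u \<partial>M) - (\<integral>u. r u * G s0 u \<partial>M)\<bar> \<le> e)"
    using X by blast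
qed

text \<open>Integrand and measure move at once. Changing \<open>s\<close> costs at most e/2
  uniformly in \<open>u\<close>, hence against every probability measure; changing \<open>t\<close>
  with the integrand \<open>G s0\<close> frozen is weak continuity.\<close>

lemma continuous_on_kernel_integral:
  fixes G :: "'s::topological_space \<Rightarrow> 'a::topological_space \<Rightarrow> real"
    and \<kappa> :: "'t::topological_space \<Rightarrow> 'a measure"
  assumes K: "compact (UNIV :: 'a set)" and G: "continuous_on UNIV (\<lambda>(s, u). G s u)"
    and \<kappa>: "weakly_continuous_kernel \<kappa>"
  shows "continuous_on UNIV (\<lambda>(s, t). \<integral>u. G s u \<partial>\<kappa> t)"
proof (rule continuous_on_UNIV_realI)
  fix z :: "'s \<times> 't" and e :: real assume e: "0 < e"
  obtain s0 t0 where z: "z = (s0, t0)" by (cases z)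
  have k: "prob_space (\<kappa> t)" "sets (\<kappa> t) = sets borel" "finite_measure (\<kappa> t)" for t
    using \<kappa> by (auto simp: weakly_continuous_kernel_def tau_measure_def)
  have Gs: "continuous_on UNIV (G s)" for s
    by (rule continuous_on_compose_pair[OF G]; intro continuous_intros)
  have i: "integrable (\<kappa> t) (G s)" for s t by (rule compact_continuous_integrable[OF K Gs k(2,3)])
  have "0 < e / 2" using e by simp
  from uniform_in_compact_factor[OF K G this, of s0] obtain X
    where X: "open X" "s0 \<in> X" "\<And>s u. s \<in> X \<Longrightarrow> \<bar>G s u - G s0 u\<bar> \<le> e / 2" by blast
  have "continuous_on UNIV (\<lambda>t. \<integral>u. G s0 u \<partial>\<kappa> t)"
    using \<kappa> Gs by (auto simp: weakly_continuous_kernel_def)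
  then have "open {t. \<bar>(\<integral>u. G s0 u \<partial>\<kappa> t) - (\<integral>u. G s0 u \<partial>\<kappa> t0)\<bar> < e / 2}" (is "open ?Y")
    by (intro open_Collect_less continuous_intros)
  have "\<bar>(\<integral>u. G s u \<partial>\<kappa> t) - (\<integral>u. G s0 u \<partial>\<kappa> t0)\<bar> \<le> e" if st: "s \<in> X" "t \<in> ?Y" for s t
  proof -
    interpret prob_space "\<kappa> t" by (rule k)
    have "\<bar>(\<integral>u. G s u \<partial>\<kappa> t) - (\<integral>u. G s0 u \<partial>\<kappa> t)\<bar> = \<bar>\<integral>u. G s u - G s0 u \<partial>\<kappa> t\<bar>" using i by simp
    also have "\<dots> \<le> (\<integral>u. \<bar>G s u - G s0 u\<bar> \<partial>\<kappa> t)" by (rule integral_abs_bound)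
    also have "\<dots> \<le> (\<integral>u. e / 2 \<partial>\<kappa> t)" using X(3)[OF st(1)] i by (intro integral_mono) auto
    also have "\<dots> = e / 2" by (simp add: prob_space)
    finally have "\<bar>(\<integral>u. G s u \<partial>\<kappa> t) - (\<integral>u. G s0 u \<partial>\<kappa> t)\<bar> \<le> e / 2" .
    moreover have "\<bar>(\<integral>u. G s0 u \<partial>\<kappa> t) - (\<integral>u. G s0 u \<partial>\<kappa> t0)\<bar> < e / 2" using st(2) by simp
    ultimately show ?thesis by linarith
  qed
  then show "\<exists>W. open W \<and> z \<in> W \<and>
      (\<forall>y\<in>W. \<bar>(case y of (s, t) \<Rightarrow> \<integral>u. G s u \<partial>\<kappa> t) - (case z of (s, t) \<Rightarrow> \<integral>u. G s u \<partial>\<kappa> t)\<bar> \<le> e)"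
    using X \<open>open ?Y\<close> e by (intro exI[of _ "X \<times> ?Y"]) (auto simp: z open_Times)
qed

section \<open>Supports of measures\<close>

lemma continuous_integral_zero_imp_zero_on_msupp:
  fixes g :: "'a::topological_space \<Rightarrow> real"
  assumes K: "compact (UNIV :: 'a set)" and M: "sets M = sets borel" "finite_measure M"
    and g: "continuous_on UNIV g" "\<And>x. 0 \<le> g x" and zero: "(\<integral>x. g x \<partial>M) = 0" and x: "x \<in> msupp M"
  shows "g x = 0"
proof (rule ccontr)
  assume "g x \<noteq> 0"
  then have "x \<in> {x. 0 < g x}" using g(2)[of x] by simp
  moreover have "open {x. 0 < g x}" using g(1) by (intro open_Collect_less continuous_intros)
  ultimately have "emeasure M {x. 0 < g x} \<noteq> 0" using x by (auto simp: msupp_def)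
  moreover have "AE x in M. g x = 0"
    using zero g(2) by (subst (asm) integral_nonneg_eq_0_iff_AE[OF compact_continuous_integrable[OF K g(1) M]]) auto
  then have "AE x in M. \<not> 0 < g x" by eventually_elim simp
  from emeasure_eq_0_AE[OF this] have "emeasure M {x. 0 < g x} = 0"
    using sets_eq_imp_space_eq[OF M(1)] by simp
  ultimately show False by simp
qed

text \<open>Off the support every point has a null open neighbourhood. Uncountably many of these may
  be involved, but a compact subset of U is covered by finitely many, and inner regularity then
  passes to U.\<close>

lemma radon_emeasure_disjoint_msupp:
  assumes M: "radon_measure M" and "open U" "U \<inter> msupp M = {}"
  shows "emeasure M U = 0"
proof -
  have sets: "sets M = sets borel"
    and inner: "emeasure M U = (SUP C\<in>{C. compact C \<and> C \<subseteq> U}. emeasure M C)"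
    using M \<open>open U\<close> by (auto simp: radon_measure_def)
  have "emeasure M C = 0" if C: "compact C" "C \<subseteq> U" for C
  proof -
    let ?N = "{V. open V \<and> emeasure M V = 0}"
    have "C \<subseteq> \<Union>?N"
    proof
      fix x assume "x \<in> C"
      then have "x \<notin> msupp M" using C(2) assms(3) by auto
      then show "x \<in> \<Union>?N" by (auto simp: msupp_def)
    qed
    then obtain D where D: "D \<subseteq> ?N" "finite D" "C \<subseteq> \<Union>D" by (rule compactE[OF C(1)]) auto
    have "emeasure M C \<le> emeasure M (\<Union>D)" using D by (intro emeasure_mono) (auto simp: sets intro!: borel_open open_Union)
    also have "\<dots> \<le> (\<Sum>V\<in>D. emeasure M V)"
      using emeasure_subadditive_finite[of D "\<lambda>V. V" M] D borel_open by (simp add: sets subset_iff)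
    also have "\<dots> = 0" using D by (intro sum.neutral) auto
    finally show ?thesis by simp
  qed
  then show ?thesis unfolding inner by (intro antisym SUP_least) auto
qed

subsection \<open>Compact hypergroups\<close>

locale cpt_hypergroup =
  fixes conv :: "'a::t2_space \<Rightarrow> 'a \<Rightarrow> 'a measure" and invo :: "'a \<Rightarrow> 'a" and e :: 'a
  assumes hypergroup: "compact_hypergroup conv invo e"
begin

lemma K: "compact (UNIV :: 'a set)"
  and conv_prob: "prob_space (conv x y)" and conv_radon: "radon_measure (conv x y)"
  and conv_unit: "conv e x = return borel x" "conv x e = return borel x"
  and invo_cont: "continuous_on UNIV invo" and invo_invo [simp]: "invo (invo x) = x"
  and e_in_msupp_iff: "e \<in> msupp (conv x y) \<longleftrightarrow> x = invo y"
  and conv_distr_invo: "distr (conv x y) borel invo = conv (invo y) (invo x)"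
  using hypergroup by (auto simp: compact_hypergroup_def)

lemma
  fixes f :: "'a \<Rightarrow> real"
  shows conv_assoc:
    "continuous_on UNIV f \<Longrightarrow> (\<integral>u. hval conv f u z \<partial>conv x y) = (\<integral>v. hval conv f x v \<partial>conv y z)"
  and hval_continuous_pair:
    "continuous_on UNIV f \<Longrightarrow> continuous_on UNIV (\<lambda>(x, y). hval conv f x y)"
  and open_msupp_subset: "open U \<Longrightarrow> open {(x, y). msupp (conv x y) \<subseteq> U}"
  using hypergroup by (auto simp: compact_hypergroup_def)

lemma conv_sets: "sets (conv x y) = sets borel" and conv_finite: "finite_measure (conv x y)"
  using conv_radon[of x y] by (auto simp: radon_measure_def)

lemma hval_continuous:
  fixes f :: "'a \<Rightarrow> real"
  assumes "continuous_on UNIV f" "continuous_on UNIV a" "continuous_on UNIV b"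
  shows "continuous_on UNIV (\<lambda>z. hval conv f (a z) (b z))"
  by (rule continuous_on_compose_pair[OF hval_continuous_pair assms(2,3)]) fact

lemma conv_kernel:
  assumes "continuous_on UNIV a" "continuous_on UNIV b"
  shows "weakly_continuous_kernel (\<lambda>z. conv (a z) (b z))"
  unfolding weakly_continuous_kernel_def
  using conv_prob radon_imp_tau_measure[OF K conv_radon] hval_continuous[OF _ assms]
  by (auto simp: hval_def)

lemma conv_integrable: "continuous_on UNIV f \<Longrightarrow> integrable (conv x y) f" for f :: "'a \<Rightarrow> real"
  by (intro compact_continuous_integrable[OF K _ conv_sets conv_finite])

lemma hval_nonneg: "(\<And>x. 0 \<le> f x) \<Longrightarrow> 0 \<le> hval conv f x y" for f :: "'a \<Rightarrow> real"
  by (simp add: hval_def)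

lemma hval_close:
  fixes f g :: "'a \<Rightarrow> real"
  assumes "continuous_on UNIV f" "continuous_on UNIV g" "\<And>u. \<bar>f u - g u\<bar> \<le> d"
  shows "\<bar>hval conv f x y - hval conv g x y\<bar> \<le> d"
proof -
  interpret prob_space "conv x y" by (rule conv_prob)
  note i = conv_integrable[OF assms(1)] conv_integrable[OF assms(2)]
  have "\<bar>hval conv f x y - hval conv g x y\<bar> = \<bar>\<integral>u. f u - g u \<partial>conv x y\<bar>" using i by (simp add: hval_def)
  also have "\<dots> \<le> (\<integral>u. \<bar>f u - g u\<bar> \<partial>conv x y)" by (rule integral_abs_bound)
  also have "\<dots> \<le> (\<integral>u. d \<partial>conv x y)" using assms(3) i by (intro integral_mono) auto
  finally show ?thesis by (simp add: prob_space)
qed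

lemma integral_conv_invo:
  fixes f :: "'a \<Rightarrow> real"
  assumes "continuous_on UNIV f"
  shows "(\<integral>u. f (invo u) \<partial>conv x y) = (\<integral>u. f u \<partial>conv (invo y) (invo x))"
proof -
  have "f \<in> borel_measurable borel" "invo \<in> conv x y \<rightarrow>\<^sub>M borel"
    using assms invo_cont
    by (auto simp: measurable_cong_sets[OF conv_sets refl] intro: borel_measurable_continuous_onI)
  then show ?thesis by (simp add: conv_distr_invo[symmetric] integral_distr)
qed

lemma continuous_on_invo: "continuous_on S a \<Longrightarrow> continuous_on S (\<lambda>z. invo (a z))"
  by (rule continuous_on_compose2[OF invo_cont]) auto

lemma hval_invo_swap:
  fixes f :: "'a \<Rightarrow> real"
  assumes "continuous_on UNIV f"
  shows "hval conv f (invo z) u = hval conv (\<lambda>w. f (invo w)) (invo u) z"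
  using integral_conv_invo[OF assms, of "invo u" z] by (simp add: hval_def)

text \<open>Writing ^-1 for the involution, this brackets k(z^-1 * x * y) in two ways: the right
  side uses that z^-1 * x is the involute of x^-1 * z.\<close>

lemma hval_invo_assoc:
  fixes k :: "'a \<Rightarrow> real"
  assumes k: "continuous_on UNIV k"
  shows "(\<integral>u. hval conv k (invo z) u \<partial>conv x y) = (\<integral>v. hval conv k (invo v) y \<partial>conv (invo x) z)"
proof -
  have "continuous_on UNIV (\<lambda>v. hval conv k v y)" by (intro hval_continuous k continuous_intros)
  from integral_conv_invo[OF this, of "invo x" z] show ?thesis using conv_assoc[OF k, where x = "invo z" and y = x and z = y] by simp
qed

end

section \<open>Haar measure: inversion, approximate identities and adjoint translations\<close>

locale cpt_hypergroup_haar = cpt_hypergroup conv invo e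
  for conv :: "'a::t2_space \<Rightarrow> 'a \<Rightarrow> 'a measure" and invo e +
  fixes \<omega> :: "'a measure"
  assumes haar: "left_haar_measure conv \<omega>"
begin

lemma \<omega>_radon: "radon_measure \<omega>" and \<omega>_sets: "sets \<omega> = sets borel" and \<omega>_finite: "finite_measure \<omega>"
  and \<omega>_UNIV: "emeasure \<omega> UNIV \<noteq> 0"
  and left_invariant: "continuous_on UNIV f \<Longrightarrow> (\<integral>y. hval conv f x y \<partial>\<omega>) = (\<integral>y. f y \<partial>\<omega>)" for f :: "'a \<Rightarrow> real"
  using haar by (auto simp: left_haar_measure_def radon_measure_def)

lemma \<omega>_space [simp]: "space \<omega> = UNIV"
  using sets_eq_imp_space_eq[OF \<omega>_sets] by simp

sublocale haar: finite_measure \<omega> by (rule \<omega>_finite)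

lemma measure_\<omega>_pos: "0 < measure \<omega> UNIV"
  using \<omega>_UNIV by (simp add: haar.emeasure_eq_measure zero_less_measure_iff)

lemma \<omega>_integrable: "continuous_on UNIV f \<Longrightarrow> integrable \<omega> f" for f :: "'a \<Rightarrow> real"
  by (rule compact_continuous_integrable[OF K _ \<omega>_sets \<omega>_finite])

text \<open>Integrate f over the convolution of the inverted and the original Haar measure in both orders.\<close>

lemma inversion_invariant:
  fixes f :: "'a \<Rightarrow> real"
  assumes f: "continuous_on UNIV f"
  shows "(\<integral>y. f (invo y) \<partial>\<omega>) = (\<integral>y. f y \<partial>\<omega>)"
proof -
  have fi: "continuous_on UNIV (\<lambda>w. f (invo w))" by (intro continuous_on_compose2[OF f] invo_cont) auto
  have c: "continuous_on UNIV (\<lambda>(x, y). hval conv f (invo x) y)"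
    unfolding case_prod_beta' by (intro hval_continuous f continuous_on_invo continuous_intros)
  have "measure \<omega> UNIV * (\<integral>y. f y \<partial>\<omega>) = (\<integral>x. (\<integral>y. hval conv f (invo x) y \<partial>\<omega>) \<partial>\<omega>)"
    by (simp add: left_invariant[OF f])
  also have "\<dots> = (\<integral>y. (\<integral>x. hval conv f (invo x) y \<partial>\<omega>) \<partial>\<omega>)"
    by (rule Fubini_continuous'[OF K K \<omega>_sets \<omega>_finite \<omega>_sets \<omega>_finite c])
  \<comment> \<open>For fixed y, \<open>hval_invo_swap\<close> turns the integrand into a left
    translate, in the variable x, of f composed with the involution, so left invariance applies a
    second time.\<close>
  also have "\<dots> = measure \<omega> UNIV * (\<integral>y. f (invo y) \<partial>\<omega>)"
    by (simp add: hval_invo_swap[OF f] left_invariant[OF fi])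
  finally show ?thesis using measure_\<omega>_pos by simp
qed

text \<open>With left invariance, this gives the kernel k(z^-1 * u) the same total mass in either
  variable, so smoothing from either side is averaging once k has integral 1.\<close>

lemma integral_hval_invo_left:
  fixes k :: "'a \<Rightarrow> real"
  assumes k: "continuous_on UNIV k"
  shows "(\<integral>z. hval conv k (invo z) u \<partial>\<omega>) = (\<integral>u. k u \<partial>\<omega>)"
proof -
  have "continuous_on UNIV (\<lambda>w. k (invo w))" by (intro continuous_on_compose2[OF k] invo_cont) auto
  then show ?thesis by (simp add: hval_invo_swap[OF k] left_invariant inversion_invariant[OF k])
qed

lemma hval_kernel_continuous:
  fixes k :: "'a \<Rightarrow> real"
  assumes k: "continuous_on UNIV k"
  shows "continuous_on UNIV (\<lambda>(z, u). hval conv k (invo z) u)"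
    "continuous_on UNIV (\<lambda>(u, z). hval conv k (invo z) u)"
  unfolding case_prod_beta' by (intro hval_continuous k continuous_on_invo continuous_intros)+

text \<open>If the integral were 0, so would be that of the translate of k by the involute of y. For
  y in the support of \<omega> this translate would vanish at y, and as e lies in the support of
  y^-1 * y this would force k e = 0. So \<omega> would have empty support and be zero.\<close>

lemma integral_pos_near_unit:
  fixes k :: "'a \<Rightarrow> real"
  assumes k: "continuous_on UNIV k" "\<And>x. 0 \<le> k x" and "0 < k e"
  shows "0 < (\<integral>x. k x \<partial>\<omega>)"
proof (rule ccontr)
  assume "\<not> 0 < (\<integral>x. k x \<partial>\<omega>)"
  moreover have "0 \<le> (\<integral>x. k x \<partial>\<omega>)" using k(2) by simp
  ultimately have zero: "(\<integral>x. k x \<partial>\<omega>) = 0" by simp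
  have "y \<notin> msupp \<omega>" for y
  proof
    assume "y \<in> msupp \<omega>"
    have "hval conv k (invo y) y = 0"
    proof (rule continuous_integral_zero_imp_zero_on_msupp
        [OF K \<omega>_sets \<omega>_finite, where g = "hval conv k (invo y)", OF _ _ _ \<open>y \<in> msupp \<omega>\<close>])
      show "continuous_on UNIV (hval conv k (invo y))" by (intro hval_continuous k continuous_intros)
      show "(\<integral>x. hval conv k (invo y) x \<partial>\<omega>) = 0" using zero left_invariant[OF k(1)] by simp
    qed (intro hval_nonneg k)
    then have "k e = 0"
      unfolding hval_def
      by (rule continuous_integral_zero_imp_zero_on_msupp[OF K conv_sets conv_finite k])
         (simp add: e_in_msupp_iff)
    with assms(3) show False by simp
  qed
  then have "emeasure \<omega> UNIV = 0"
    by (intro radon_emeasure_disjoint_msupp[OF \<omega>_radon]) auto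
  with \<omega>_UNIV show False by simp
qed

text \<open>By H3 the condition that the support of v\<inverse> * y avoids a neighbourhood of e is open in (v, y);
  compactness of the complement of W then yields a neighbourhood that serves all (v, y) outside W.\<close>

lemma approximate_identity:
  assumes W: "open W" "\<And>x. (x, x) \<in> W"
  obtains k :: "'a \<Rightarrow> real" where "continuous_on UNIV k" "\<And>x. 0 \<le> k x" "(\<integral>x. k x \<partial>\<omega>) = 1"
    "\<And>v y. (v, y) \<notin> W \<Longrightarrow> hval conv k (invo v) y = 0"
proof -
  \<comment> \<open>Taking the closure makes this an inclusion of the support in an open set, which
    is the form that (H3) controls.\<close>
  define A where "A V = {z. msupp (conv (invo (fst z)) (snd z)) \<subseteq> - closure V}" for V
  have "open (A V)" for V
  proof -
    have "open ((\<lambda>z. (invo (fst z), snd z)) -` {(x, y). msupp (conv x y) \<subseteq> - closure V})"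
      by (intro open_vimage open_msupp_subset continuous_on_Pair continuous_on_invo continuous_intros) auto
    then show ?thesis by (simp add: A_def vimage_def)
  qed
  define VV where "VV = {V :: 'a set. open V \<and> e \<in> V}"
  have "- W \<subseteq> (\<Union>V\<in>VV. A V)"
  proof
    fix z assume "z \<in> - W"
    then have "fst z \<noteq> snd z" using W(2)[of "fst z"] by (cases z) auto
    then have "invo (fst z) \<noteq> invo (snd z)" by (metis invo_invo)
    then have "e \<notin> msupp (conv (invo (fst z)) (snd z))" by (simp add: e_in_msupp_iff)
    then obtain U where U: "open U" "e \<in> U" "emeasure (conv (invo (fst z)) (snd z)) U = 0"
      by (auto simp: msupp_def)
    have disj: "U \<inter> msupp (conv (invo (fst z)) (snd z)) = {}" using U by (auto simp: msupp_def)
    \<comment> \<open>The Urysohn function shrinks U: its superlevel set at 1/2 is an open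
      neighbourhood of e with closure inside U.\<close>
    obtain g :: "'a \<Rightarrow> real" where g: "continuous_on UNIV g" "\<And>x. x \<in> {e} \<Longrightarrow> g x = 1" "\<And>x. x \<notin> U \<Longrightarrow> g x = 0"
      by (rule compact_t2_Urysohn[OF K closed_singleton U(1), of e]) (use U in auto)
    let ?V = "{x. 1/2 < g x}"
    have "open ?V" using g(1) by (intro open_Collect_less continuous_intros)
    moreover have "closure ?V \<subseteq> {x. 1/2 \<le> g x}"
      using g(1) by (intro closure_minimal closed_Collect_le continuous_intros) auto
    moreover have "{x. 1/2 \<le> g x} \<subseteq> U" using g(3) by force
    ultimately show "z \<in> (\<Union>V\<in>VV. A V)"
      using disj g(2) by (intro UN_I[of ?V]) (auto simp: VV_def A_def)
  qed
  moreover have "compact (- W)"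
  proof -
    have "compact (UNIV \<inter> - W)"
      using compact_Times[OF K K] W(1) by (intro compact_Int_closed) auto
    then show ?thesis by simp
  qed
  ultimately obtain D where D: "D \<subseteq> VV" "finite D" "- W \<subseteq> (\<Union>V\<in>D. A V)"
    using \<open>\<And>V. open (A V)\<close> by (elim compactE_image[of "- W" VV A]) auto
  \<comment> \<open>A function k that vanishes off the intersection vanishes off every V in D, so
    one k serves for whichever \<open>A V\<close> contains the given pair.\<close>
  have V: "open (\<Inter>D)" "e \<in> \<Inter>D" using D by (auto simp: VV_def subset_iff)
  obtain k :: "'a \<Rightarrow> real" where k: "continuous_on UNIV k" "\<And>x. 0 \<le> k x"
      "\<And>x. x \<in> {e} \<Longrightarrow> k x = 1" "\<And>x. x \<notin> \<Inter>D \<Longrightarrow> k x = 0"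
    by (rule compact_t2_Urysohn[OF K closed_singleton V(1), of e]) (use V in auto)
  have pos: "0 < (\<integral>x. k x \<partial>\<omega>)" using k by (intro integral_pos_near_unit) auto
  have zero: "hval conv k (invo v) y = 0" if vy: "(v, y) \<notin> W" for v y
  proof -
    have "(v, y) \<in> (\<Union>V\<in>D. A V)" using vy D(3) by blast
    then obtain V where V: "V \<in> D" "msupp (conv (invo v) y) \<subseteq> - closure V"
      by (auto simp: A_def)
    have "emeasure (conv (invo v) y) V = 0"
      using V D(1) closure_subset[of V]
      by (intro radon_emeasure_disjoint_msupp[OF conv_radon]) (auto simp: VV_def)
    then have "AE u in conv (invo v) y. u \<notin> V"
      using V D(1) by (intro AE_not_in null_setsI) (auto simp: conv_sets VV_def)
    then have "AE u in conv (invo v) y. k u = 0" by eventually_elim (use k(4) V(1) in auto)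
    then have "hval conv k (invo v) y = (\<integral>u. 0 \<partial>conv (invo v) y)"
      unfolding hval_def using conv_integrable[OF k(1)] by (intro integral_cong_AE) auto
    then show ?thesis by simp
  qed
  show thesis
  proof (rule that[of "\<lambda>x. k x / (\<integral>x. k x \<partial>\<omega>)"])
    show "continuous_on UNIV (\<lambda>x. k x / (\<integral>x. k x \<partial>\<omega>))" using k(1) pos by (intro continuous_intros) auto
    show "0 \<le> k x / (\<integral>x. k x \<partial>\<omega>)" for x using k(2) pos by simp
    show "(\<integral>x. k x / (\<integral>x. k x \<partial>\<omega>) \<partial>\<omega>) = 1" using pos by simp
    show "hval conv (\<lambda>x. k x / (\<integral>x. k x \<partial>\<omega>)) (invo v) y = 0" if "(v, y) \<notin> W" for v y
      using zero[OF that] by (simp add: hval_def)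
  qed
qed

text \<open>For fixed \<open>u\<close> the kernel is a probability density in its other variable, on
  either side, and lives where g differs from \<open>g u\<close> by at most
  \<open>d\<close>.\<close>

lemma approximate_identity_close:
  fixes g k :: "'a \<Rightarrow> real"
  assumes g: "continuous_on UNIV g" and k: "continuous_on UNIV k" "\<And>x. 0 \<le> k x" "(\<integral>x. k x \<partial>\<omega>) = 1"
    and near: "\<And>v y. hval conv k (invo v) y \<noteq> 0 \<Longrightarrow> \<bar>g y - g v\<bar> \<le> d"
  shows "\<bar>(\<integral>z. g z * hval conv k (invo z) u \<partial>\<omega>) - g u\<bar> \<le> d" (is ?left)
    and "\<bar>(\<integral>y. g y * hval conv k (invo u) y \<partial>\<omega>) - g u\<bar> \<le> d" (is ?right)
proof -
  have close: "\<bar>(\<integral>z. g z * w z \<partial>\<omega>) - g u\<bar> \<le> d"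
    if w: "continuous_on UNIV w" "\<And>z. 0 \<le> w z" "(\<integral>z. w z \<partial>\<omega>) = 1" "\<And>z. w z \<noteq> 0 \<Longrightarrow> \<bar>g z - g u\<bar> \<le> d" for w
  proof -
    have i: "integrable \<omega> w" "integrable \<omega> (\<lambda>z. g z * w z)"
      using w(1) g by (auto intro!: \<omega>_integrable continuous_intros)
    have "\<bar>(\<integral>z. g z * w z \<partial>\<omega>) - g u\<bar> = \<bar>\<integral>z. g z * w z - g u * w z \<partial>\<omega>\<bar>" using i w(3) by simp
    also have "\<dots> \<le> (\<integral>z. \<bar>g z * w z - g u * w z\<bar> \<partial>\<omega>)" by (rule integral_abs_bound)
    also have "\<dots> \<le> (\<integral>z. d * w z \<partial>\<omega>)"
    proof (rule integral_mono)
      fix z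
      have "\<bar>g z - g u\<bar> * w z \<le> d * w z"
        using w(2,4)[of z] by (cases "w z = 0") (auto intro!: mult_right_mono)
      then show "\<bar>g z * w z - g u * w z\<bar> \<le> d * w z"
        using w(2)[of z] by (simp add: left_diff_distrib[symmetric] abs_mult)
    qed (use i in auto)
    also have "\<dots> = d" using w(3) by simp
    finally show ?thesis .
  qed
  have c: "continuous_on UNIV (\<lambda>z. hval conv k (invo z) u)" "continuous_on UNIV (hval conv k (invo u))"
    by (intro hval_continuous k continuous_on_invo continuous_intros)+
  show ?left
    using near by (intro close c hval_nonneg k) (auto simp: integral_hval_invo_left[OF k(1)] k(3) abs_minus_commute)
  show ?right
    using near by (intro close c hval_nonneg k) (auto simp: left_invariant[OF k(1)] k(3))
qed

text \<open>Smooth f and g with an approximate identity k. For the smoothed functions both sides are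
  the same triple integral of f(z) g(y) k(z\<inverse> * x * y), by associativity.\<close>

lemma translation_adjoint:
  fixes f g :: "'a \<Rightarrow> real"
  assumes f: "continuous_on UNIV f" and g: "continuous_on UNIV g"
  shows "(\<integral>y. hval conv f x y * g y \<partial>\<omega>) = (\<integral>z. f z * hval conv g (invo x) z \<partial>\<omega>)" (is "?L = ?R")
proof -
  obtain Bf where Bf: "0 < Bf" "\<And>x. \<bar>f x\<bar> \<le> Bf" using compact_continuous_bounded[OF K f] by blast
  obtain Bg where Bg: "0 < Bg" "\<And>x. \<bar>g x\<bar> \<le> Bg" using compact_continuous_bounded[OF K g] by blast
  \<comment> \<open>Replacing f by its smoothing costs d times the bound of g times the total mass,
    and replacing g costs the same with the bound of f; c collects both.\<close>
  define c where "c = (Bf + Bg) * measure \<omega> UNIV"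
  have c: "0 < c" using Bf Bg measure_\<omega>_pos by (simp add: c_def)
  have "\<bar>?L - ?R\<bar> \<le> c * d" if d: "0 < d" for d
  proof -
    let ?W = "{z. \<bar>f (snd z) - f (fst z)\<bar> < d} \<inter> {z. \<bar>g (snd z) - g (fst z)\<bar> < d}"
    have "open ?W"
      by (intro open_Int open_Collect_less continuous_intros continuous_on_compose2[OF f] continuous_on_compose2[OF g]) auto
    moreover have "(x, x) \<in> ?W" for x using d by simp
    ultimately obtain k :: "'a \<Rightarrow> real" where k: "continuous_on UNIV k" "\<And>x. 0 \<le> k x" "(\<integral>x. k x \<partial>\<omega>) = 1"
        "\<And>v y. (v, y) \<notin> ?W \<Longrightarrow> hval conv k (invo v) y = 0"
      using approximate_identity[of ?W] by blast
    have near: "\<bar>f y - f v\<bar> \<le> d" "\<bar>g y - g v\<bar> \<le> d" if "hval conv k (invo v) y \<noteq> 0" for v y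
    proof -
      have "(v, y) \<in> ?W" using k(4) that by blast
      then show "\<bar>f y - f v\<bar> \<le> d" "\<bar>g y - g v\<bar> \<le> d" by auto
    qed
    define a where "a u = (\<integral>z. f z * hval conv k (invo z) u \<partial>\<omega>)" for u
    define b where "b v = (\<integral>y. g y * hval conv k (invo v) y \<partial>\<omega>)" for v
    have a: "\<bar>a u - f u\<bar> \<le> d" for u
      unfolding a_def by (rule approximate_identity_close(1)[OF f k(1-3) near(1)])
    have b: "\<bar>b u - g u\<bar> \<le> d" for u
      unfolding b_def by (rule approximate_identity_close(2)[OF g k(1-3) near(2)])
    have ca: "continuous_on UNIV a" unfolding a_def
      by (rule continuous_on_weighted_integral[OF K hval_kernel_continuous(2)[OF k(1)] \<omega>_sets \<omega>_integrable[OF f]])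
    have cb: "continuous_on UNIV b" unfolding b_def
      by (rule continuous_on_weighted_integral[OF K hval_kernel_continuous(1)[OF k(1)] \<omega>_sets \<omega>_integrable[OF g]])
    \<comment> \<open>\<open>Q z y\<close> stands for k(z^-1 * x * y). The definition averages over
      x * y, as the translate of \<open>a\<close> requires; \<open>Q'\<close> averages over x^-1 *
      z, as the translate of \<open>b\<close> requires.\<close>
    define Q where "Q z y = (\<integral>u. hval conv k (invo z) u \<partial>conv x y)" for z y
    have Q': "Q z y = (\<integral>v. hval conv k (invo v) y \<partial>conv (invo x) z)" for z y
      unfolding Q_def by (rule hval_invo_assoc[OF k(1)])
    have cQ: "continuous_on UNIV (\<lambda>(z, y). Q z y)" unfolding Q_def
      by (intro continuous_on_kernel_integral[OF K hval_kernel_continuous(1)[OF k(1)]] conv_kernel continuous_intros)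
    have cQg: "continuous_on UNIV (\<lambda>(z, y). Q z y * g y)"
      using cQ unfolding case_prod_beta' by (intro continuous_intros continuous_on_compose2[OF g]) auto
    have ha: "hval conv a x y = (\<integral>z. f z * Q z y \<partial>\<omega>)" for y
      unfolding hval_def[of conv a] a_def Q_def
      by (rule Fubini_continuous[OF K K \<omega>_sets \<omega>_finite conv_sets conv_finite
            hval_kernel_continuous(1)[OF k(1)] \<omega>_integrable[OF f], symmetric])
    have hb: "hval conv b (invo x) z = (\<integral>y. g y * Q z y \<partial>\<omega>)" for z
      unfolding hval_def[of conv b] b_def Q'
      by (rule Fubini_continuous[OF K K \<omega>_sets \<omega>_finite conv_sets conv_finite
            hval_kernel_continuous(2)[OF k(1)] \<omega>_integrable[OF g], symmetric])
    have "(\<integral>y. hval conv a x y * g y \<partial>\<omega>) = (\<integral>y. (\<integral>z. f z * (Q z y * g y) \<partial>\<omega>) \<partial>\<omega>)"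
      unfolding ha by (simp add: mult.assoc flip: Bochner_Integration.integral_mult_left_zero)
    also have "\<dots> = (\<integral>z. f z * (\<integral>y. Q z y * g y \<partial>\<omega>) \<partial>\<omega>)"
      by (rule Fubini_continuous[OF K K \<omega>_sets \<omega>_finite \<omega>_sets \<omega>_finite cQg \<omega>_integrable[OF f], symmetric])
    also have "\<dots> = (\<integral>z. f z * hval conv b (invo x) z \<partial>\<omega>)" unfolding hb by (simp add: mult.commute)
    finally have eq: "(\<integral>y. hval conv a x y * g y \<partial>\<omega>) = (\<integral>z. f z * hval conv b (invo x) z \<partial>\<omega>)" .
    have ch: "continuous_on UNIV (hval conv h x')" if "continuous_on UNIV h" for h :: "'a \<Rightarrow> real" and x'
      using that by (intro hval_continuous continuous_intros)
    have diff: "\<bar>(\<integral>y. p y * s y \<partial>\<omega>) - (\<integral>y. q y * s y \<partial>\<omega>)\<bar> \<le> d * (B * measure \<omega> UNIV)"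
      if "continuous_on UNIV p" "continuous_on UNIV q" "continuous_on UNIV s"
        "\<And>y. \<bar>p y - q y\<bar> \<le> d" "\<And>y. \<bar>s y\<bar> \<le> B" for p q s :: "'a \<Rightarrow> real" and B
    proof -
      have i: "integrable \<omega> (\<lambda>y. p y * s y)" "integrable \<omega> (\<lambda>y. q y * s y)"
        using that by (auto intro!: \<omega>_integrable continuous_intros)
      have "\<bar>(\<integral>y. p y * s y \<partial>\<omega>) - (\<integral>y. q y * s y \<partial>\<omega>)\<bar> = \<bar>\<integral>y. p y * s y - q y * s y \<partial>\<omega>\<bar>"
        using i by simp
      also have "\<dots> \<le> (\<integral>y. \<bar>p y * s y - q y * s y\<bar> \<partial>\<omega>)" by (rule integral_abs_bound)
      also have "\<dots> \<le> (\<integral>y. d * B \<partial>\<omega>)"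
      proof (rule integral_mono)
        show "\<bar>p y * s y - q y * s y\<bar> \<le> d * B" for y
          unfolding left_diff_distrib[symmetric] abs_mult using that(4,5)[of y] by (intro mult_mono) auto
      qed (use i in auto)
      finally show ?thesis by (simp add: ac_simps)
    qed
    have "\<bar>?L - (\<integral>y. hval conv a x y * g y \<partial>\<omega>)\<bar> \<le> d * (Bg * measure \<omega> UNIV)"
      by (intro diff ch f ca g hval_close Bg) (use a in \<open>simp add: abs_minus_commute\<close>)
    moreover have "\<bar>?R - (\<integral>z. f z * hval conv b (invo x) z \<partial>\<omega>)\<bar> \<le> d * (Bf * measure \<omega> UNIV)"
      unfolding mult.commute[of "f _"]
      by (intro diff ch g cb f hval_close Bf) (use b in \<open>simp add: abs_minus_commute\<close>)
    ultimately have "\<bar>?L - ?R\<bar> \<le> d * (Bg * measure \<omega> UNIV) + d * (Bf * measure \<omega> UNIV)"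
      using eq by linarith
    then show ?thesis by (simp add: c_def algebra_simps)
  qed
  note bound = this
  have "\<bar>?L - ?R\<bar> \<le> 0 + \<epsilon>" if "0 < \<epsilon>" for \<epsilon>
    using bound[of "\<epsilon> / c"] that c by simp
  then have "\<bar>?L - ?R\<bar> \<le> 0" by (rule field_le_epsilon)
  then show ?thesis by simp
qed

text \<open>In effect \<omega> has full support. Smoothing g with an approximate identity sees only
  its almost everywhere value 0, yet the result at \<open>u\<close> is within \<open>d\<close> of
  \<open>g u\<close>.\<close>

lemma continuous_integral_zero:
  fixes g :: "'a \<Rightarrow> real"
  assumes g: "continuous_on UNIV g" "\<And>x. 0 \<le> g x" and zero: "(\<integral>x. g x \<partial>\<omega>) = 0"
  shows "g u = 0"
proof -
  have ae: "AE x in \<omega>. g x = 0"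
    using zero g(2) by (subst (asm) integral_nonneg_eq_0_iff_AE[OF \<omega>_integrable[OF g(1)]]) auto
  have "g u \<le> 0 + d" if d: "0 < d" for d
  proof -
    let ?W = "{z. \<bar>g (snd z) - g (fst z)\<bar> < d}"
    have "open ?W" by (intro open_Collect_less continuous_intros continuous_on_compose2[OF g(1)]) auto
    moreover have "(x, x) \<in> ?W" for x using d by simp
    ultimately obtain k :: "'a \<Rightarrow> real" where k: "continuous_on UNIV k" "\<And>x. 0 \<le> k x" "(\<integral>x. k x \<partial>\<omega>) = 1"
        "\<And>v y. (v, y) \<notin> ?W \<Longrightarrow> hval conv k (invo v) y = 0"
      using approximate_identity[of ?W] by blast
    have near: "\<bar>g y - g v\<bar> \<le> d" if "hval conv k (invo v) y \<noteq> 0" for v y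
    proof -
      have "(v, y) \<in> ?W" using k(4) that by blast
      then show ?thesis by simp
    qed
    have c: "continuous_on UNIV (\<lambda>z. g z * hval conv k (invo z) u)"
      by (intro continuous_intros g hval_continuous k continuous_on_invo)
    have "(\<integral>z. g z * hval conv k (invo z) u \<partial>\<omega>) = (\<integral>z. 0 \<partial>\<omega>)"
      using \<omega>_integrable[OF c] ae by (intro integral_cong_AE) auto
    then show ?thesis using approximate_identity_close(1)[OF g(1) k(1-3) near, of u] by simp
  qed
  then have "g u \<le> 0" by (rule field_le_epsilon)
  then show ?thesis using g(2)[of u] by simp
qed

section \<open>The mean square oscillation under translation\<close>

text \<open>For continuous F, vanishing means that F equals \<open>F x\<close> on the whole support
  of \<open>conv a x\<close>, whereas \<open>hval conv F a x = F x\<close> would only fix a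
  mean.\<close>

definition oscillation :: "('a \<Rightarrow> real) \<Rightarrow> 'a \<Rightarrow> 'a \<Rightarrow> real" where
  "oscillation F a x = hval conv (\<lambda>u. (F u - F x)\<^sup>2) a x"

lemma oscillation_nonneg: "0 \<le> oscillation F a x"
  by (auto simp: oscillation_def intro: hval_nonneg)

lemma oscillation_expand:
  assumes F: "continuous_on UNIV F"
  shows "oscillation F a x = hval conv (\<lambda>u. (F u)\<^sup>2) a x - 2 * (F x * hval conv F a x) + (F x)\<^sup>2"
proof -
  interpret prob_space "conv a x" by (rule conv_prob)
  have i: "integrable (conv a x) (\<lambda>u. (F u)\<^sup>2)" "integrable (conv a x) F"
    using F by (auto intro!: conv_integrable continuous_intros)
  have "oscillation F a x = (\<integral>u. (F u)\<^sup>2 - 2 * F x * F u + (F x)\<^sup>2 \<partial>conv a x)"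
    by (simp add: oscillation_def hval_def power2_diff algebra_simps)
  also have "\<dots> = (\<integral>u. (F u)\<^sup>2 \<partial>conv a x) - 2 * F x * (\<integral>u. F u \<partial>conv a x) + (F x)\<^sup>2"
    using i by (simp add: prob_space)
  finally show ?thesis by (simp add: hval_def)
qed

lemma oscillation_continuous:
  assumes F: "continuous_on UNIV F" and "continuous_on UNIV a" "continuous_on UNIV b"
  shows "continuous_on UNIV (\<lambda>z. oscillation F (a z) (b z))"
  unfolding oscillation_expand[OF F] using assms
  by (intro continuous_intros hval_continuous continuous_on_compose2[OF F]) auto

lemma integral_oscillation:
  assumes F: "continuous_on UNIV F"
  shows "(\<integral>x. oscillation F a x \<partial>\<omega>) = 2 * (\<integral>x. (F x)\<^sup>2 \<partial>\<omega>) - 2 * (\<integral>x. F x * hval conv F a x \<partial>\<omega>)"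
proof -
  have F2: "continuous_on UNIV (\<lambda>u. (F u)\<^sup>2)" using F by (intro continuous_intros)
  have i: "integrable \<omega> (\<lambda>x. hval conv (\<lambda>u. (F u)\<^sup>2) a x)" "integrable \<omega> (\<lambda>x. F x * hval conv F a x)"
      "integrable \<omega> (\<lambda>x. (F x)\<^sup>2)"
    using F F2 by (auto intro!: \<omega>_integrable hval_continuous continuous_intros)
  show ?thesis unfolding oscillation_expand[OF F] using i by (simp add: left_invariant[OF F2])
qed

lemma integral_oscillation_invo:
  assumes F: "continuous_on UNIV F"
  shows "(\<integral>x. oscillation F (invo a) x \<partial>\<omega>) = (\<integral>x. oscillation F a x \<partial>\<omega>)"
  using translation_adjoint[OF F F, of a] by (simp add: integral_oscillation[OF F] mult.commute)

text \<open>Almost everywhere under b * x one has F v = F x, so there the squared deviation from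
  \<open>F x\<close>, averaged over a * v, is \<open>oscillation F a v\<close>, which is 0.
  Associativity turns this into a vanishing integral over a * b of a continuous nonnegative
  function, which is therefore 0 on the support.\<close>

lemma oscillation_zero_msupp:
  assumes F: "continuous_on UNIV F"
    and a: "\<And>x. oscillation F a x = 0" and b: "\<And>x. oscillation F b x = 0" and w: "w \<in> msupp (conv a b)"
  shows "oscillation F w x = 0"
proof -
  let ?\<phi> = "\<lambda>u. (F u - F x)\<^sup>2"
  have \<phi>: "continuous_on UNIV ?\<phi>" using F by (intro continuous_intros)
  have "(\<integral>v. ?\<phi> v \<partial>conv b x) = 0" using b[of x] by (simp add: oscillation_def hval_def)
  then have "AE v in conv b x. F v = F x"
    by (subst (asm) integral_nonneg_eq_0_iff_AE[OF conv_integrable[OF \<phi>]]) auto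
  then have ae: "AE v in conv b x. hval conv ?\<phi> a v = 0"
  proof eventually_elim
    case (elim v) then show ?case using a[of v] by (simp add: oscillation_def)
  qed
  have c: "continuous_on UNIV (hval conv ?\<phi> a)" "continuous_on UNIV (\<lambda>w. hval conv ?\<phi> w x)"
    by (intro hval_continuous \<phi> continuous_intros)+
  have "(\<integral>w. hval conv ?\<phi> w x \<partial>conv a b) = (\<integral>v. hval conv ?\<phi> a v \<partial>conv b x)" by (rule conv_assoc[OF \<phi>])
  also have "\<dots> = (\<integral>v. 0 \<partial>conv b x)" using ae conv_integrable[OF c(1)] by (intro integral_cong_AE) auto
  finally have "(\<integral>w. hval conv ?\<phi> w x \<partial>conv a b) = 0" by simp
  from continuous_integral_zero_imp_zero_on_msupp[OF K conv_sets conv_finite c(2) _ this w]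
  show ?thesis by (simp add: oscillation_def hval_nonneg)
qed

end

section \<open>Continuous harmonic functions of an adapted measure\<close>

locale adapted_hypergroup = cpt_hypergroup_haar conv invo e \<omega>
  for conv :: "'a::t2_space \<Rightarrow> 'a \<Rightarrow> 'a measure" and invo e \<omega> +
  fixes \<sigma> :: "'a measure"
  assumes \<sigma>_prob: "prob_space \<sigma>" and \<sigma>_radon: "radon_measure \<sigma>" and \<sigma>_adapted: "adapted conv invo \<sigma>"
begin

lemma \<sigma>_sets: "sets \<sigma> = sets borel" and \<sigma>_finite: "finite_measure \<sigma>"
  using \<sigma>_radon by (auto simp: radon_measure_def)

sublocale sigma: prob_space \<sigma> by (rule \<sigma>_prob)

lemma continuous_harmonic_constant:
  fixes F :: "'a \<Rightarrow> real"
  assumes F: "continuous_on UNIV F" and harmonic: "\<And>x. (\<integral>y. hval conv F (invo y) x \<partial>\<sigma>) = F x"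
  shows "F x = F e"
proof -
  have c1: "continuous_on UNIV (\<lambda>(x, y). oscillation F (invo y) x)"
    unfolding case_prod_beta' by (intro oscillation_continuous F continuous_on_invo continuous_intros)
  have c2: "continuous_on UNIV (\<lambda>(x, y). hval conv F (invo y) x)"
    unfolding case_prod_beta' by (intro hval_continuous F continuous_on_invo continuous_intros)
  have c4: "continuous_on UNIV (\<lambda>y. \<integral>x. F x * hval conv F (invo y) x \<partial>\<omega>)"
    by (intro continuous_on_weighted_integral[OF K _ \<omega>_sets \<omega>_integrable[OF F]])
       (unfold case_prod_beta', intro hval_continuous F continuous_on_invo continuous_intros)
  have "(\<integral>x. (\<integral>y. oscillation F (invo y) x \<partial>\<sigma>) \<partial>\<omega>) = (\<integral>y. (\<integral>x. oscillation F (invo y) x \<partial>\<omega>) \<partial>\<sigma>)"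
    by (rule Fubini_continuous'[OF K K \<omega>_sets \<omega>_finite \<sigma>_sets \<sigma>_finite c1])
  also have "\<dots> = 2 * (\<integral>x. (F x)\<^sup>2 \<partial>\<omega>) - 2 * (\<integral>y. (\<integral>x. F x * hval conv F (invo y) x \<partial>\<omega>) \<partial>\<sigma>)"
    unfolding integral_oscillation[OF F]
    using compact_continuous_integrable[OF K c4 \<sigma>_sets \<sigma>_finite] by (simp add: sigma.prob_space)
  \<comment> \<open>Exchanging the order exposes the \<sigma>-average of the translates, which
    harmonicity replaces by F; the two terms then cancel.\<close>
  also have "(\<integral>y. (\<integral>x. F x * hval conv F (invo y) x \<partial>\<omega>) \<partial>\<sigma>) = (\<integral>x. F x * (\<integral>y. hval conv F (invo y) x \<partial>\<sigma>) \<partial>\<omega>)"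
    by (rule Fubini_continuous[OF K K \<omega>_sets \<omega>_finite \<sigma>_sets \<sigma>_finite c2 \<omega>_integrable[OF F], symmetric])
  finally have zero: "(\<integral>x. (\<integral>y. oscillation F (invo y) x \<partial>\<sigma>) \<partial>\<omega>) = 0"
    by (simp add: harmonic power2_eq_square)
  have "continuous_on UNIV (\<lambda>x. \<integral>y. 1 * oscillation F (invo y) x \<partial>\<sigma>)"
    by (rule continuous_on_weighted_integral[OF K c1 \<sigma>_sets]) simp
  then have "(\<integral>y. oscillation F (invo y) x \<partial>\<sigma>) = 0" for x
    by (intro continuous_integral_zero[OF _ _ zero]) (simp_all add: oscillation_nonneg)
  then have S: "oscillation F (invo y) x = 0" if "y \<in> msupp \<sigma>" for x y
    using that
    by (intro continuous_integral_zero_imp_zero_on_msupp[OF K \<sigma>_sets \<sigma>_finite, where g = "\<lambda>y. oscillation F (invo y) x"]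
        oscillation_continuous F continuous_on_invo continuous_intros oscillation_nonneg)
  \<comment> \<open>So far only the involutes of support points are treated; the integrated
    oscillation does not see the involution, so the support points themselves follow.\<close>
  have "oscillation F y x = 0" if "y \<in> msupp \<sigma>" for x y
  proof (rule continuous_integral_zero)
    show "(\<integral>x. oscillation F y x \<partial>\<omega>) = 0"
      using integral_oscillation_invo[OF F, of y] S[OF that] by simp
  qed (intro oscillation_continuous F continuous_intros oscillation_nonneg)+
  with S have gen: "oscillation F a x = 0" if "a \<in> msupp \<sigma> \<union> invo ` msupp \<sigma>" for a x
    using that by auto
  let ?Z = "{a. \<forall>x. oscillation F a x = 0}"
  have "setpow conv (msupp \<sigma> \<union> invo ` msupp \<sigma>) n \<subseteq> ?Z" for n
  proof (induction n)
    case 0 show ?case unfolding setpow.simps using gen by blast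
  next
    case (Suc n)
    show ?case
    proof
      fix w assume "w \<in> setpow conv (msupp \<sigma> \<union> invo ` msupp \<sigma>) (Suc n)"
      then obtain a b where ab: "a \<in> setpow conv (msupp \<sigma> \<union> invo ` msupp \<sigma>) n"
          "b \<in> msupp \<sigma> \<union> invo ` msupp \<sigma>" "w \<in> msupp (conv a b)"
        unfolding setpow.simps setconv_def by blast
      then have "oscillation F a x = 0" for x using Suc by blast
      from oscillation_zero_msupp[OF F this gen[OF ab(2)] ab(3)] show "w \<in> ?Z" by blast
    qed
  qed
  moreover have "closed ?Z"
    unfolding Collect_all_eq
    by (intro closed_INT ballI closed_Collect_eq oscillation_continuous F continuous_intros)
  ultimately have "closure (\<Union>n. setpow conv (msupp \<sigma> \<union> invo ` msupp \<sigma>) n) \<subseteq> ?Z"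
    by (intro closure_minimal) auto
  \<comment> \<open>As \<open>conv x e\<close> is the unit mass at x, this oscillation is the single
    square (F x - F e)^2.\<close>
  then have "oscillation F x e = 0" using \<sigma>_adapted unfolding adapted_def by blast
  moreover have "(\<lambda>u. (F u - F e)\<^sup>2) \<in> borel_measurable borel"
    using F by (intro borel_measurable_continuous_onI continuous_intros)
  ultimately show ?thesis
    by (simp add: oscillation_def hval_def conv_unit integral_return)
qed

section \<open>Convolution by \<sigma> as a Markov kernel, and its adjoint\<close>

text \<open>This is the involute of \<sigma> convolved with the unit mass at x. It presents
  (\<sigma> * f)(x) as one integral of f, provided that f is integrable for this measure.\<close>

definition transition :: "'a \<Rightarrow> 'a measure" where
  "transition x = \<sigma> \<bind> (\<lambda>y. conv (invo y) x)"

lemma conv_invo_kernel: "weakly_continuous_kernel (\<lambda>y. conv (invo y) x)"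
  by (intro conv_kernel continuous_on_invo continuous_intros)

lemma integral_transition:
  "continuous_on UNIV g \<Longrightarrow> (\<integral>u. g u \<partial>transition x) = (\<integral>y. hval conv g (invo y) x \<partial>\<sigma>)" for g :: "'a \<Rightarrow> real"
  unfolding transition_def hval_def by (rule tau_measure_bind(2)[OF K \<sigma>_radon conv_invo_kernel])

lemma conv_invo_measurable: "(\<lambda>y. conv (invo y) x) \<in> \<sigma> \<rightarrow>\<^sub>M subprob_algebra borel"
  using weakly_continuous_kernel_measurable[OF conv_invo_kernel]
  by (simp add: measurable_cong_sets[OF \<sigma>_sets refl])

lemma transition_kernel: "weakly_continuous_kernel transition"
  unfolding weakly_continuous_kernel_def
proof (intro conjI allI impI)
  show "prob_space (transition x)" for x
    unfolding transition_def
    by (rule sigma.prob_space_bind[OF _ conv_invo_measurable]) (simp add: conv_prob)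
  show "tau_measure (transition x)" for x
    unfolding transition_def by (rule tau_measure_bind(1)[OF K \<sigma>_radon conv_invo_kernel])
  fix g :: "'a \<Rightarrow> real" assume g: "continuous_on UNIV g"
  have "continuous_on UNIV (\<lambda>x. \<integral>y. 1 * hval conv g (invo y) x \<partial>\<sigma>)"
    by (rule continuous_on_weighted_integral[OF K hval_kernel_continuous(2)[OF g] \<sigma>_sets]) simp
  then show "continuous_on UNIV (\<lambda>x. \<integral>u. g u \<partial>transition x)" by (simp add: integral_transition[OF g])
qed

lemma transition_measurable: "transition \<in> borel \<rightarrow>\<^sub>M subprob_algebra borel"
  by (rule weakly_continuous_kernel_measurable[OF transition_kernel])

text \<open>This is convolution of \<open>h\<close> by the involute of \<sigma>, the
  \<omega>-adjoint of integration against \<open>transition\<close>.\<close>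

definition dual_transition :: "('a \<Rightarrow> real) \<Rightarrow> 'a \<Rightarrow> real" where
  "dual_transition h z = (\<integral>y. hval conv h y z \<partial>\<sigma>)"

lemma dual_transition_continuous:
  assumes h: "continuous_on UNIV h"
  shows "continuous_on UNIV (dual_transition h)"
proof -
  have "continuous_on UNIV (\<lambda>(z, y). hval conv h y z)"
    unfolding case_prod_beta' by (intro hval_continuous h continuous_intros)
  then have "continuous_on UNIV (\<lambda>z. \<integral>y. 1 * hval conv h y z \<partial>\<sigma>)"
    by (rule continuous_on_weighted_integral[OF K _ \<sigma>_sets]) simp
  then show ?thesis by (simp add: dual_transition_def[abs_def])
qed

lemma dual_transition_nonneg: "(\<And>x. 0 \<le> h x) \<Longrightarrow> 0 \<le> dual_transition h x"
  unfolding dual_transition_def by (intro Bochner_Integration.integral_nonneg hval_nonneg)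

lemma density_\<omega>_radon:
  fixes h :: "'a \<Rightarrow> real"
  assumes "integrable \<omega> h" "\<And>x. 0 \<le> h x"
  shows "radon_measure (density \<omega> h)"
  using assms by (intro radon_measure_density[OF \<omega>_radon]) (auto simp: nn_integral_eq_integral)

lemma integral_density_\<omega>:
  fixes h g :: "'a \<Rightarrow> real"
  assumes "integrable \<omega> h" "\<And>x. 0 \<le> h x" "g \<in> borel_measurable borel"
  shows "(\<integral>x. g x \<partial>density \<omega> h) = (\<integral>x. h x * g x \<partial>\<omega>)"
  using assms by (subst integral_density) (auto simp: measurable_cong_sets[OF \<omega>_sets refl])

text \<open>Adjointness is available for continuous functions, and these distinguish
  \<tau>-measures. As an equality of measures it extends to Borel functions, which gives
  \<open>transition_duality\<close>.\<close>

lemma bind_density_transition: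
  assumes h: "continuous_on UNIV h" "\<And>x. 0 \<le> h x"
  shows "density \<omega> h \<bind> transition = density \<omega> (dual_transition h)"
proof (rule tau_measure_eqI)
  note hi = \<omega>_integrable[OF h(1)]
  have T: "continuous_on UNIV (dual_transition h)" "\<And>x. 0 \<le> dual_transition h x"
    by (rule dual_transition_continuous[OF h(1)]) (rule dual_transition_nonneg[OF h(2)])
  note Ti = \<omega>_integrable[OF T(1)]
  show "tau_measure (density \<omega> h \<bind> transition)"
    by (rule tau_measure_bind(1)[OF K density_\<omega>_radon[OF hi h(2)] transition_kernel])
  show "tau_measure (density \<omega> (dual_transition h))"
    by (rule radon_imp_tau_measure[OF K density_\<omega>_radon[OF Ti T(2)]])
  fix g :: "'a \<Rightarrow> real" assume g: "continuous_on UNIV g"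
  have gP: "continuous_on UNIV (\<lambda>x. \<integral>u. g u \<partial>transition x)"
    using transition_kernel g by (auto simp: weakly_continuous_kernel_def)
  have ch: "continuous_on UNIV (\<lambda>(z, y). hval conv h y z)"
    unfolding case_prod_beta' by (intro hval_continuous h continuous_intros)
  have "(\<integral>x. g x \<partial>(density \<omega> h \<bind> transition)) = (\<integral>x. (\<integral>u. g u \<partial>transition x) \<partial>density \<omega> h)"
    by (rule tau_measure_bind(2)[OF K density_\<omega>_radon[OF hi h(2)] transition_kernel g])
  also have "\<dots> = (\<integral>x. h x * (\<integral>y. hval conv g (invo y) x \<partial>\<sigma>) \<partial>\<omega>)"
    using integral_density_\<omega>[OF hi h(2) borel_measurable_continuous_onI[OF gP]]
    by (simp add: integral_transition[OF g])
  also have "\<dots> = (\<integral>y. (\<integral>x. h x * hval conv g (invo y) x \<partial>\<omega>) \<partial>\<sigma>)"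
    by (rule Fubini_continuous[OF K K \<omega>_sets \<omega>_finite \<sigma>_sets \<sigma>_finite hval_kernel_continuous(2)[OF g] hi])
  also have "\<dots> = (\<integral>y. (\<integral>x. g x * hval conv h y x \<partial>\<omega>) \<partial>\<sigma>)"
    using translation_adjoint[OF h(1) g] by (simp add: mult.commute)
  also have "\<dots> = (\<integral>x. g x * dual_transition h x \<partial>\<omega>)"
    unfolding dual_transition_def
    by (rule Fubini_continuous[OF K K \<omega>_sets \<omega>_finite \<sigma>_sets \<sigma>_finite ch \<omega>_integrable[OF g], symmetric])
  also have "\<dots> = (\<integral>x. g x \<partial>density \<omega> (dual_transition h))"
    using integral_density_\<omega>[OF Ti T(2) borel_measurable_continuous_onI[OF g]] by (simp add: mult.commute)
  finally show "(\<integral>x. g x \<partial>(density \<omega> h \<bind> transition)) = (\<integral>x. g x \<partial>density \<omega> (dual_transition h))" .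
qed

text \<open>The constant 1 is fixed by the adjoint, so \<omega> is stationary. Thus an
  \<omega>-integrable function is integrable, and an \<omega>-null set null, for
  \<open>transition x\<close> at almost every x.\<close>

lemma bind_transition: "\<omega> \<bind> transition = \<omega>"
proof -
  have "dual_transition (\<lambda>_. 1) = (\<lambda>_. 1)"
    by (simp add: dual_transition_def hval_def fun_eq_iff prob_space.prob_space[OF conv_prob] sigma.prob_space)
  then show ?thesis using bind_density_transition[of "\<lambda>_. 1"] by (simp add: density_1)
qed

lemma transition_duality:
  assumes r: "r \<in> borel_measurable borel" "integrable \<omega> r" and h: "continuous_on UNIV h" "\<And>x. 0 \<le> h x"
  shows "(\<integral>x. h x * (\<integral>u. r u \<partial>transition x) \<partial>\<omega>) = (\<integral>x. r x * dual_transition h x \<partial>\<omega>)"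
proof -
  note hi = \<omega>_integrable[OF h(1)]
  have T: "continuous_on UNIV (dual_transition h)" "\<And>x. 0 \<le> dual_transition h x"
    by (rule dual_transition_continuous[OF h(1)]) (rule dual_transition_nonneg[OF h(2)])
  note Ti = \<omega>_integrable[OF T(1)]
  have tm: "transition \<in> density \<omega> h \<rightarrow>\<^sub>M subprob_algebra borel"
    using transition_measurable by (simp add: \<omega>_sets cong: measurable_cong_sets)
  have "integrable \<omega> (\<lambda>x. dual_transition h x * r x)"
    using integrable_mult_continuous[OF K T(1) \<omega>_sets r(2)] by (simp add: mult.commute)
  then have int: "integrable (density \<omega> h \<bind> transition) r"
    unfolding bind_density_transition[OF h] using r Ti T(2)
    by (subst integrable_density) auto
  have "(\<lambda>x. \<integral>u. r u \<partial>transition x) \<in> borel_measurable borel"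
    by (rule measurable_compose[OF transition_measurable integral_measurable_subprob_algebra[OF r(1)]])
  from integral_density_\<omega>[OF hi h(2) this]
  have "(\<integral>x. h x * (\<integral>u. r u \<partial>transition x) \<partial>\<omega>) = (\<integral>x. (\<integral>u. r u \<partial>transition x) \<partial>density \<omega> h)" by simp
  also have "\<dots> = (\<integral>x. r x \<partial>(density \<omega> h \<bind> transition))" by (rule integral_bind_real[OF tm r(1) int])
  also have "\<dots> = (\<integral>x. r x * dual_transition h x \<partial>\<omega>)"
    unfolding bind_density_transition[OF h] using integral_density_\<omega>[OF Ti T(2) r(1)] by (simp add: mult.commute)
  finally show ?thesis .
qed

section \<open>From smoothed to integrable harmonic functions\<close>

text \<open>Smoothing acts on the right and \<sigma> on the left. Associativity and duality
  therefore move the \<sigma>-average from the smoothed function onto \<open>r\<close> itself, where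
  harmonicity absorbs it.\<close>

lemma smoothed_harmonic_constant:
  fixes k r :: "'a \<Rightarrow> real"
  assumes k: "continuous_on UNIV k" "\<And>x. 0 \<le> k x"
    and r: "r \<in> borel_measurable borel" "integrable \<omega> r" "AE x in \<omega>. (\<integral>u. r u \<partial>transition x) = r x"
  shows "(\<integral>z. r z * hval conv k (invo z) x \<partial>\<omega>) = (\<integral>z. r z * hval conv k (invo z) e \<partial>\<omega>)"
proof (rule continuous_harmonic_constant[of "\<lambda>x. \<integral>z. r z * hval conv k (invo z) x \<partial>\<omega>"])
  let ?F = "\<lambda>x. \<integral>z. r z * hval conv k (invo z) x \<partial>\<omega>"
  show "continuous_on UNIV ?F"
    by (rule continuous_on_weighted_integral[OF K hval_kernel_continuous(2)[OF k(1)] \<omega>_sets r(2)])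
  fix x
  define h where "h v = hval conv k (invo v) x" for v
  have h: "continuous_on UNIV h" "\<And>v. 0 \<le> h v"
    unfolding h_def by (intro hval_continuous k continuous_on_invo continuous_intros hval_nonneg)+
  have ch: "continuous_on UNIV (\<lambda>(z, y). hval conv h y z)"
    unfolding case_prod_beta' by (intro hval_continuous h continuous_intros)
  \<comment> \<open>With h v = k(v^-1 * x), this rewrites k(z^-1 * y^-1 * x) as h(y * z), since the
    involution reverses products.\<close>
  have "hval conv ?F (invo y) x = (\<integral>z. r z * hval conv h y z \<partial>\<omega>)" for y
  proof -
    have "hval conv ?F (invo y) x = (\<integral>z. r z * (\<integral>u. hval conv k (invo z) u \<partial>conv (invo y) x) \<partial>\<omega>)"
      unfolding hval_def[of conv ?F]
      by (rule Fubini_continuous[OF K K \<omega>_sets \<omega>_finite conv_sets conv_finite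
            hval_kernel_continuous(1)[OF k(1)] r(2), symmetric])
    also have "\<dots> = (\<integral>z. r z * hval conv h y z \<partial>\<omega>)"
      unfolding hval_invo_assoc[OF k(1)] by (simp add: hval_def[of conv h] h_def)
    finally show ?thesis .
  qed
  then have "(\<integral>y. hval conv ?F (invo y) x \<partial>\<sigma>) = (\<integral>y. (\<integral>z. r z * hval conv h y z \<partial>\<omega>) \<partial>\<sigma>)" by simp
  also have "\<dots> = (\<integral>z. r z * dual_transition h z \<partial>\<omega>)"
    unfolding dual_transition_def
    by (rule Fubini_continuous[OF K K \<omega>_sets \<omega>_finite \<sigma>_sets \<sigma>_finite ch r(2), symmetric])
  also have "\<dots> = (\<integral>z. h z * (\<integral>u. r u \<partial>transition z) \<partial>\<omega>)" by (rule transition_duality[OF r(1,2) h, symmetric])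
  also have "\<dots> = (\<integral>z. h z * r z \<partial>\<omega>)"
  proof (rule integral_cong_AE)
    have [measurable]: "h \<in> borel_measurable \<omega>" "r \<in> borel_measurable \<omega>"
        "(\<lambda>x. \<integral>u. r u \<partial>transition x) \<in> borel_measurable \<omega>"
      using borel_measurable_continuous_onI[OF h(1)] r(1)
        measurable_compose[OF transition_measurable integral_measurable_subprob_algebra[OF r(1)]]
      by (simp_all add: measurable_cong_sets[OF \<omega>_sets refl])
    show "(\<lambda>z. h z * (\<integral>u. r u \<partial>transition z)) \<in> borel_measurable \<omega>" "(\<lambda>z. h z * r z) \<in> borel_measurable \<omega>"
      by measurable
    show "AE z in \<omega>. h z * (\<integral>u. r u \<partial>transition z) = h z * r z" using r(3) by eventually_elim simp
  qed
  also have "\<dots> = ?F x" by (simp add: h_def mult.commute)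
  finally show "(\<integral>y. hval conv ?F (invo y) x \<partial>\<sigma>) = ?F x" .
qed

text \<open>Smoothing \<open>r\<close> by k on the right is dual to smoothing g. The smoothed
  \<open>r\<close> is a constant, while the smoothed g is uniformly within \<open>d\<close> of g, so
  the two sides differ by at most a fixed multiple of \<open>d\<close>.\<close>

lemma harmonic_integral_mult:
  fixes g r :: "'a \<Rightarrow> real"
  assumes g: "continuous_on UNIV g"
    and r: "r \<in> borel_measurable borel" "integrable \<omega> r" "AE x in \<omega>. (\<integral>u. r u \<partial>transition x) = r x"
  shows "(\<integral>x. r x * g x \<partial>\<omega>) = (\<integral>x. r x \<partial>\<omega>) / measure \<omega> UNIV * (\<integral>x. g x \<partial>\<omega>)" (is "?L = ?R")
proof -
  define c where "c = (\<integral>x. \<bar>r x\<bar> \<partial>\<omega>) + 1"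
  have c: "0 < c" "(\<integral>x. \<bar>r x\<bar> \<partial>\<omega>) \<le> c"
    using Bochner_Integration.integral_nonneg[of \<omega> "\<lambda>x. \<bar>r x\<bar>"] unfolding c_def by linarith+
  have bound: "\<bar>?L - ?R\<bar> \<le> c * d" if d: "0 < d" for d
  proof -
    let ?W = "{z. \<bar>g (snd z) - g (fst z)\<bar> < d}"
    have "open ?W" by (intro open_Collect_less continuous_intros continuous_on_compose2[OF g]) auto
    moreover have "(x, x) \<in> ?W" for x using d by simp
    ultimately obtain k :: "'a \<Rightarrow> real" where k: "continuous_on UNIV k" "\<And>x. 0 \<le> k x" "(\<integral>x. k x \<partial>\<omega>) = 1"
        "\<And>v y. (v, y) \<notin> ?W \<Longrightarrow> hval conv k (invo v) y = 0"
      using approximate_identity[of ?W] by blast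
    have near: "\<bar>g y - g v\<bar> \<le> d" if "hval conv k (invo v) y \<noteq> 0" for v y
    proof -
      have "(v, y) \<in> ?W" using k(4) that by blast
      then show ?thesis by simp
    qed
    define C where "C = (\<integral>z. r z * hval conv k (invo z) e \<partial>\<omega>)"
    have C: "(\<integral>z. r z * hval conv k (invo z) x \<partial>\<omega>) = C" for x
      unfolding C_def by (rule smoothed_harmonic_constant[OF k(1,2) r])
    define b where "b z = (\<integral>x. g x * hval conv k (invo z) x \<partial>\<omega>)" for z
    have b: "\<bar>b z - g z\<bar> \<le> d" for z
      unfolding b_def by (rule approximate_identity_close(2)[OF g k(1-3) near])
    have cb: "continuous_on UNIV b" unfolding b_def
      by (rule continuous_on_weighted_integral[OF K hval_kernel_continuous(1)[OF k(1)] \<omega>_sets \<omega>_integrable[OF g]])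
    have cg: "continuous_on UNIV (\<lambda>(z, x). g x * hval conv k (invo z) x)"
      unfolding case_prod_beta'
      by (intro continuous_intros continuous_on_compose2[OF g] hval_continuous k continuous_on_invo) auto
    \<comment> \<open>The kernel has mass 1 in x, so integrating the constant C over x returns the
      integral of \<open>r\<close>. Hence C is the mean of \<open>r\<close>, whatever k is.\<close>
    have "(\<integral>x. r x \<partial>\<omega>) = (\<integral>z. r z * (\<integral>x. hval conv k (invo z) x \<partial>\<omega>) \<partial>\<omega>)"
      by (simp add: left_invariant[OF k(1)] k(3))
    also have "\<dots> = (\<integral>x. (\<integral>z. r z * hval conv k (invo z) x \<partial>\<omega>) \<partial>\<omega>)"
      by (rule Fubini_continuous[OF K K \<omega>_sets \<omega>_finite \<omega>_sets \<omega>_finite hval_kernel_continuous(1)[OF k(1)] r(2)])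
    finally have "(\<integral>x. r x \<partial>\<omega>) = C * measure \<omega> UNIV" by (simp add: C mult.commute)
    then have Cr: "C = (\<integral>x. r x \<partial>\<omega>) / measure \<omega> UNIV" using measure_\<omega>_pos by simp
    have "(\<integral>z. r z * b z \<partial>\<omega>) = (\<integral>x. (\<integral>z. r z * (g x * hval conv k (invo z) x) \<partial>\<omega>) \<partial>\<omega>)"
      unfolding b_def by (rule Fubini_continuous[OF K K \<omega>_sets \<omega>_finite \<omega>_sets \<omega>_finite cg r(2)])
    also have "\<dots> = (\<integral>x. g x * (\<integral>z. r z * hval conv k (invo z) x \<partial>\<omega>) \<partial>\<omega>)"
      by (simp add: mult.left_commute)
    also have "\<dots> = ?R" by (simp add: C Cr)
    finally have eq: "(\<integral>z. r z * b z \<partial>\<omega>) = ?R" .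
    have i: "integrable \<omega> (\<lambda>z. r z * b z)" "integrable \<omega> (\<lambda>z. r z * g z)"
      by (rule integrable_mult_continuous[OF K _ \<omega>_sets r(2)]; fact)+
    have "\<bar>?L - ?R\<bar> = \<bar>\<integral>z. r z * g z - r z * b z \<partial>\<omega>\<bar>" using i by (simp add: eq)
    also have "\<dots> \<le> (\<integral>z. \<bar>r z * g z - r z * b z\<bar> \<partial>\<omega>)" by (rule integral_abs_bound)
    also have "\<dots> \<le> (\<integral>z. \<bar>r z\<bar> * d \<partial>\<omega>)"
    proof (rule integral_mono)
      show "\<bar>r z * g z - r z * b z\<bar> \<le> \<bar>r z\<bar> * d" for z
        unfolding right_diff_distrib[symmetric] abs_mult
        using b[of z] by (intro mult_left_mono) (simp_all add: abs_minus_commute)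
    qed (use i r(2) in auto)
    also have "\<dots> = (\<integral>z. \<bar>r z\<bar> \<partial>\<omega>) * d" by simp
    also have "\<dots> \<le> c * d" using c d by (intro mult_right_mono) auto
    finally show ?thesis .
  qed
  have "\<bar>?L - ?R\<bar> \<le> 0 + \<epsilon>" if "0 < \<epsilon>" for \<epsilon>
    using bound[of "\<epsilon> / c"] that c by simp
  then have "\<bar>?L - ?R\<bar> \<le> 0" by (rule field_le_epsilon)
  then show ?thesis by simp
qed

text \<open>With c the mean of \<open>r\<close>, r - c is orthogonal to every continuous function.
  Its positive and negative parts thus define Radon measures with equal integrals of continuous
  functions, so they agree almost everywhere; never being positive together, both vanish
  there.\<close>

lemma harmonic_constant_real:
  fixes r :: "'a \<Rightarrow> real"
  assumes r: "r \<in> borel_measurable borel" "integrable \<omega> r" "AE x in \<omega>. (\<integral>u. r u \<partial>transition x) = r x"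
  shows "\<exists>c. AE x in \<omega>. r x = c"
proof
  define c where "c = (\<integral>x. r x \<partial>\<omega>) / measure \<omega> UNIV"
  define p where "p x = max 0 (r x - c)" for x
  define n where "n x = max 0 (c - r x)" for x
  have pn: "integrable \<omega> p" "\<And>x. 0 \<le> p x" "integrable \<omega> n" "\<And>x. 0 \<le> n x"
    unfolding p_def[abs_def] n_def[abs_def] using r(2) by auto
  have "density \<omega> p = density \<omega> n"
  proof (rule tau_measure_eqI)
    fix g :: "'a \<Rightarrow> real" assume g: "continuous_on UNIV g"
    note gm = borel_measurable_continuous_onI[OF g]
    have i: "integrable \<omega> (\<lambda>x. p x * g x)" "integrable \<omega> (\<lambda>x. n x * g x)" "integrable \<omega> (\<lambda>x. r x * g x)"
      by (rule integrable_mult_continuous[OF K g \<omega>_sets]; fact)+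
    have "(\<integral>x. p x * g x \<partial>\<omega>) - (\<integral>x. n x * g x \<partial>\<omega>) = (\<integral>x. p x * g x - n x * g x \<partial>\<omega>)" using i by simp
    also have "\<dots> = (\<integral>x. r x * g x - c * g x \<partial>\<omega>)"
      by (intro Bochner_Integration.integral_cong refl) (auto simp: p_def n_def max_def algebra_simps)
    also have "\<dots> = 0"
      using i(3) \<omega>_integrable[OF g] harmonic_integral_mult[OF g r] by (simp add: c_def)
    finally show "(\<integral>x. g x \<partial>density \<omega> p) = (\<integral>x. g x \<partial>density \<omega> n)"
      by (simp add: integral_density_\<omega>[OF pn(1,2) gm] integral_density_\<omega>[OF pn(3,4) gm])
  qed (intro radon_imp_tau_measure[OF K] density_\<omega>_radon pn)+
  then have "AE x in \<omega>. ennreal (p x) = ennreal (n x)"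
    using pn by (intro haar.density_unique) auto
  then show "AE x in \<omega>. r x = c"
    by eventually_elim (use pn in \<open>auto simp: p_def n_def max_def split: if_splits\<close>)
qed

lemma integrable_transition_AE:
  fixes f :: "'a \<Rightarrow> complex"
  assumes f: "f \<in> borel_measurable borel" "integrable \<omega> f"
  shows "AE x in \<omega>. integrable (transition x) f"
proof (rule integrable_bind(1))
  show "transition \<in> \<omega> \<rightarrow>\<^sub>M subprob_algebra borel"
    using transition_measurable by (simp add: measurable_cong_sets[OF \<omega>_sets refl])
qed (use f in \<open>auto simp: bind_transition\<close>)

lemma mconv_fun_eq_transition:
  assumes f: "f \<in> borel_measurable borel" "integrable (transition x) f"
  shows "mconv_fun conv invo \<sigma> f x = (\<integral>u. f u \<partial>transition x)"
  unfolding mconv_fun_def hval_def transition_def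
  by (rule integral_bind_complex[OF conv_invo_measurable f(1)]) (use f(2) in \<open>simp add: transition_def\<close>)

lemma harmonic_iff_constant:
  fixes f :: "'a \<Rightarrow> complex"
  assumes f: "f \<in> borel_measurable borel" "integrable \<omega> f"
  shows "(AE x in \<omega>. mconv_fun conv invo \<sigma> f x = f x) \<longleftrightarrow> (\<exists>c. AE x in \<omega>. f x = c)"
proof -
  note ae = integrable_transition_AE[OF f]
  have "(AE x in \<omega>. mconv_fun conv invo \<sigma> f x = f x) \<longleftrightarrow> (AE x in \<omega>. (\<integral>u. f u \<partial>transition x) = f x)"
    using ae by (intro eventually_subst) (auto elim!: eventually_mono simp: mconv_fun_eq_transition[OF f(1)])
  also have "\<dots> \<longleftrightarrow> (\<exists>c. AE x in \<omega>. f x = c)"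
  proof
    assume harm: "AE x in \<omega>. (\<integral>u. f u \<partial>transition x) = f x"
    have "\<exists>c. AE x in \<omega>. Re (f x) = c"
    proof (rule harmonic_constant_real)
      show "AE x in \<omega>. (\<integral>u. Re (f u) \<partial>transition x) = Re (f x)" using ae harm by eventually_elim (metis integral_Re)
    qed (use f in auto)
    moreover have "\<exists>c. AE x in \<omega>. Im (f x) = c"
    proof (rule harmonic_constant_real)
      show "AE x in \<omega>. (\<integral>u. Im (f u) \<partial>transition x) = Im (f x)" using ae harm by eventually_elim (metis integral_Im)
    qed (use f in auto)
    ultimately obtain a b where "AE x in \<omega>. Re (f x) = a" "AE x in \<omega>. Im (f x) = b" by blast
    then have "AE x in \<omega>. f x = Complex a b" by eventually_elim (simp add: complex_eq_iff)
    then show "\<exists>c. AE x in \<omega>. f x = c" by blast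
  next
    assume "\<exists>c. AE x in \<omega>. f x = c"
    then obtain c where c: "AE x in \<omega>. f x = c" by blast
    have tm: "transition \<in> \<omega> \<rightarrow>\<^sub>M subprob_algebra borel"
      using transition_measurable by (simp add: measurable_cong_sets[OF \<omega>_sets refl])
    \<comment> \<open>Stationarity carries the exceptional null set into the fibres: for almost
      every x it is also null for \<open>transition x\<close>, so the integral there is that of the
      constant.\<close>
    have "AE x in \<omega> \<bind> transition. f x = c" using c unfolding bind_transition .
    moreover have "Measurable.pred borel (\<lambda>x. f x = c)" using f(1) by measurable
    ultimately have "AE x in \<omega>. AE u in transition x. f u = c" by (simp add: AE_bind[OF tm])
    then show "AE x in \<omega>. (\<integral>u. f u \<partial>transition x) = f x"
      using c ae
    proof eventually_elim
      case (elim x)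
      interpret prob_space "transition x" using transition_kernel by (simp add: weakly_continuous_kernel_def)
      have "(\<integral>u. f u \<partial>transition x) = (\<integral>u. c \<partial>transition x)"
        using elim by (intro integral_cong_AE) auto
      then show ?case using elim by (simp add: prob_space)
    qed
  qed
  finally show ?thesis .
qed

end

section \<open>Reduction of all exponents to \<open>L^1\<close>\<close>

text \<open>For finite exponent q >= 1, every t >= 0 satisfies t \<le> 1 + t^q, and the constant 1
  is integrable for a finite measure.\<close>

lemma Lp_mem_imp_integrable:
  assumes M: "finite_measure M" and p: "1 \<le> p" and f: "Lp_mem M p f"
  shows "integrable M f"
proof -
  interpret finite_measure M by fact
  have fm: "f \<in> borel_measurable M" using f by (simp add: Lp_mem_def)
  show ?thesis
  proof (cases "p = \<infinity>")
    case True
    then obtain C where "AE x in M. norm (f x) \<le> C" using f by (auto simp: Lp_mem_def)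
    then show ?thesis using fm by (intro integrable_const_bound)
  next
    case False
    define q where "q = enn2real p"
    have "1 \<le> q" using p False unfolding q_def by (cases p) (auto simp: top_unique)
    have int: "integrable M (\<lambda>x. norm (f x) powr q)" using f False by (auto simp: Lp_mem_def q_def)
    show ?thesis
    proof (rule Bochner_Integration.integrable_bound[OF _ fm])
      show "integrable M (\<lambda>x. 1 + norm (f x) powr q)" using int by simp
      have "norm (f x) \<le> 1 + norm (f x) powr q" for x
      proof (cases "norm (f x) \<le> 1")
        case False
        then have "norm (f x) powr 1 \<le> norm (f x) powr q" using \<open>1 \<le> q\<close> by (intro powr_mono) auto
        then show ?thesis using False by simp
      qed (simp add: add_increasing2)
      then show "AE x in M. norm (f x) \<le> norm (1 + norm (f x) powr q)"
        by (intro AE_I2) (metis abs_of_nonneg add_nonneg_nonneg powr_ge_zero real_norm_def zero_le_one)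
    qed
  qed
qed

theorem theorem4p12:
  fixes conv :: "'a::t2_space \<Rightarrow> 'a \<Rightarrow> 'a measure" and invo :: "'a \<Rightarrow> 'a" and e :: 'a
    and \<omega> \<sigma> :: "'a measure" and p :: ennreal
  assumes "compact_hypergroup conv invo e"
    and "left_haar_measure conv \<omega>"
    and "prob_space \<sigma>" and "radon_measure \<sigma>"
    and "adapted conv invo \<sigma>"
    and "1 \<le> p"
  shows "(\<forall>c::complex. Lp_mem \<omega> p (\<lambda>_. c)) \<and>
         (\<forall>f. Lp_mem \<omega> p f \<longrightarrow>
            ((AE x in \<omega>. mconv_fun conv invo \<sigma> f x = f x) \<longleftrightarrow> (\<exists>c. AE x in \<omega>. f x = c)))"
proof (intro conjI allI impI)
  interpret adapted_hypergroup conv invo e \<omega> \<sigma>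
    by (intro adapted_hypergroup.intro cpt_hypergroup_haar.intro cpt_hypergroup.intro
        cpt_hypergroup_haar_axioms.intro adapted_hypergroup_axioms.intro assms)
  show "Lp_mem \<omega> p (\<lambda>_. c)" for c by (auto simp: Lp_mem_def)
  fix f assume f: "Lp_mem \<omega> p f"
  show "(AE x in \<omega>. mconv_fun conv invo \<sigma> f x = f x) \<longleftrightarrow> (\<exists>c. AE x in \<omega>. f x = c)"
  proof (rule harmonic_iff_constant)
    show "f \<in> borel_measurable borel" using f by (simp add: Lp_mem_def measurable_cong_sets[OF \<omega>_sets refl])
    show "integrable \<omega> f" by (rule Lp_mem_imp_integrable[OF \<omega>_finite \<open>1 \<le> p\<close> f])
  qed
qed

end
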